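(* The function $g_1^4(\tau)+g_2^4(\tau)$ is a modular function on $\Gamma_0(10)$ and satisfies \[ g_1^4(\tau)+g_2^4(\tau)=\frac{1}{g(\tau)}-2+3g(\tau). \]
   Context: Throughout, $\tau\in\mathbb{H}$, $q=e^{2\pi i\tau}$, $(a;q)_\infty=\prod_{n\ge0}(1-aq^n)$, $\eta(\tau)=q^{1/24}(q;q)_\infty$. Define $g_1(\tau)=\dfrac{(-q;q^5)_\infty(-q^4;q^5)_\infty}{(q;q^5)_\infty(q^4;q^5)_\infty}$, $g_2(\tau)=\dfrac{(-q^2;q^5)_\infty(-q^3;q^5)_\infty}{(q^2;q^5)_\infty(q^3;q^5)_\infty}$, and $g(\tau)=\dfrac{\eta^2(2\tau)\eta^4(5\tau)}{\eta^4(\tau)\eta^2(10\tau)}$. A modular function on a congruence subgroup $\Gamma$ is a function meromorphic on $\mathbb{H}$, invariant under $\Gamma$, and meromorphic at all cusps. $\Gamma_0(10)$ is the group of matrices in $\mathrm{SL}_2(\mathbb{Z})$ with lower-left entry divisible by $10$. *)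

theory Defs
  imports "HOL-Complex_Analysis.Complex_Analysis"
begin

definition upper_half_plane :: "complex set" where
  "upper_half_plane = {z. Im z > 0}"

definition qn :: "complex \<Rightarrow> complex" where
  "qn \<tau> = exp (2 * pi * \<i> * \<tau>)"

definition qpoch_inf :: "complex \<Rightarrow> complex \<Rightarrow> complex" where
  "qpoch_inf a q = (\<Prod>n. (1 - a * q ^ n))"

definition dedekind_eta :: "complex \<Rightarrow> complex" where
  "dedekind_eta \<tau> = exp (2 * pi * \<i> * \<tau> / 24) * qpoch_inf (qn \<tau>) (qn \<tau>)"

definition g1 :: "complex \<Rightarrow> complex" where
  "g1 \<tau> = (let q = qn \<tau> in
     (qpoch_inf (- q) (q^5) * qpoch_inf (- (q^4)) (q^5)) /
     (qpoch_inf q (q^5) * qpoch_inf (q^4) (q^5)))"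

definition g2 :: "complex \<Rightarrow> complex" where
  "g2 \<tau> = (let q = qn \<tau> in
     (qpoch_inf (- (q^2)) (q^5) * qpoch_inf (- (q^3)) (q^5)) /
     (qpoch_inf (q^2) (q^5) * qpoch_inf (q^3) (q^5)))"

definition g :: "complex \<Rightarrow> complex" where
  "g \<tau> = (dedekind_eta (2*\<tau>) ^ 2 * dedekind_eta (5*\<tau>) ^ 4) /
          (dedekind_eta \<tau> ^ 4 * dedekind_eta (10*\<tau>) ^ 2)"

definition moebius_act :: "int \<Rightarrow> int \<Rightarrow> int \<Rightarrow> int \<Rightarrow> complex \<Rightarrow> complex" where
  "moebius_act a b c d \<tau> = (of_int a * \<tau> + of_int b) / (of_int c * \<tau> + of_int d)"

definition in_Gamma0 :: "int \<Rightarrow> int \<Rightarrow> int \<Rightarrow> int \<Rightarrow> int \<Rightarrow> bool" where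
  "in_Gamma0 N a b c d \<longleftrightarrow> a * d - b * c = 1 \<and> N dvd c"

text \<open>f is meromorphic at the cusp gamma(i infinity), gamma = (a b; c d) in SL_2(Z):
  for some width h > 0, the function tau |-> f(gamma tau) is h-periodic, and the
  induced function F(w) = f(gamma(h log w / (2 pi i))) of the local parameter
  w = exp(2 pi i tau / h) on the punctured unit disc is meromorphic at w = 0.\<close>
definition meromorphic_at_cusp :: "(complex \<Rightarrow> complex) \<Rightarrow> int \<Rightarrow> int \<Rightarrow> int \<Rightarrow> int \<Rightarrow> bool" where
  "meromorphic_at_cusp f a b c d \<longleftrightarrow>
     (\<exists>h::nat. h > 0 \<and>
        (\<forall>\<tau>\<in>upper_half_plane. f (moebius_act a b c d (\<tau> + of_nat h)) = f (moebius_act a b c d \<tau>)) \<and>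
        (\<lambda>w. f (moebius_act a b c d (of_nat h * Ln w / (2 * pi * \<i>)))) meromorphic_on {0})"

definition modular_function_Gamma0 :: "int \<Rightarrow> (complex \<Rightarrow> complex) \<Rightarrow> bool" where
  "modular_function_Gamma0 N f \<longleftrightarrow>
     f meromorphic_on upper_half_plane \<and>
     (\<forall>a b c d. in_Gamma0 N a b c d \<longrightarrow>
        (\<forall>\<tau>\<in>upper_half_plane. f (moebius_act a b c d \<tau>) = f \<tau>)) \<and>
     (\<forall>a b c d. a * d - b * c = 1 \<longrightarrow> meromorphic_at_cusp f a b c d)"

end

theory Submission
  imports Defs
begin

text \<open>
  Put \<open>Q = q^5\<close> and \<open>f(x) = (-x; Q)(-Q/x; Q) / ((x; Q)(Q/x; Q))\<close>, so that \<open>g1 = f(q)\<close> and \<open>g2 = f(q^2) = f(q^3)\<close>.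
  A three-term theta relation (both sides are quasi-elliptic with the same multipliers and zeros)
  gives \<open>f(xy) f(x/y) (f(x)^2 - f(y)^2) = 1 - f(x)^2 f(y)^2\<close>. At \<open>x = q^2\<close>, \<open>y = q\<close> this reads
  \<open>g1 g2 (g2^2 - g1^2) = 1 - g1^2 g2^2\<close>, and since \<open>g = g1^2 g2^2\<close>, squaring yields the identity.

  For modularity, \<open>g(\<tau>) = \<vartheta>\<^sub>4(10\<tau>)^2 / \<vartheta>\<^sub>4(2\<tau>)^2\<close>. The inversion formula of the theta function follows
  from the same quasi-elliptic comparison. It permutes the squares of the three theta constants up to
  a factor of weight one; on matrices with even upper right entry \<open>\<vartheta>\<^sub>4^2\<close> has the multiplier
  \<open>\<i>^(d - 1 - c d)\<close>, which takes the same value on the two matrices that a given element of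
  \<open>\<Gamma>\<^sub>0(10)\<close> induces on \<open>10\<tau>\<close> and on \<open>2\<tau>\<close>.
\<close>

section \<open>Infinite q-products\<close>

lemma convergent_prod_qpoch:
  fixes a q :: complex
  assumes "norm q < 1"
  shows "convergent_prod (\<lambda>n. 1 - a * q ^ n)"
proof -
  have "summable (\<lambda>n. norm ((1 - a * q ^ n) - 1))"
    using assms by (simp add: norm_mult norm_power summable_geometric summable_mult)
  then show ?thesis
    by (intro abs_convergent_prod_imp_convergent_prod summable_imp_abs_convergent_prod)
qed

lemma qpoch_inf_LIMSEQ:
  assumes "norm q < 1"
  shows "(\<lambda>N. \<Prod>n<N. 1 - a * q ^ n) \<longlonglongrightarrow> qpoch_inf a q"
  using convergent_prod_LIMSEQ[OF convergent_prod_qpoch[OF assms, of a]]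
  unfolding qpoch_inf_def LIMSEQ_lessThan_iff_atMost .

text \<open>Convergence in the sense of \<open>convergent_prod\<close> leaves a nonzero tail after
  finitely many factors, so the value vanishes only through a vanishing factor.\<close>

lemma qpoch_inf_eq_0_iff:
  assumes "norm q < 1"
  shows "qpoch_inf a q = 0 \<longleftrightarrow> (\<exists>n. a * q ^ n = 1)"
proof -
  have "(\<lambda>n. 1 - a * q ^ n) has_prod qpoch_inf a q"
    unfolding qpoch_inf_def by (rule convergent_prod_has_prod[OF convergent_prod_qpoch[OF assms]])
  from has_prod_eq_0_iff[OF this] show ?thesis
    by (force simp: image_iff)
qed

lemma qpoch_inf_nonzero:
  assumes "norm q < 1" "norm a < 1"
  shows "qpoch_inf a q \<noteq> 0"
proof
  assume "qpoch_inf a q = 0"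
  then obtain n where n: "a * q ^ n = 1"
    using qpoch_inf_eq_0_iff[OF assms(1)] by blast
  have "norm (a * q ^ n) \<le> norm a * 1"
    unfolding norm_mult norm_power using assms by (intro mult_left_mono power_le_one) auto
  with n assms show False by simp
qed

lemma qpoch_inf_step:
  assumes "norm q < 1"
  shows "qpoch_inf a q = (1 - a) * qpoch_inf (a * q) q"
proof (rule LIMSEQ_unique)
  show "(\<lambda>N. \<Prod>n<Suc N. 1 - a * q ^ n) \<longlonglongrightarrow> qpoch_inf a q"
    using qpoch_inf_LIMSEQ[OF assms] by (rule LIMSEQ_Suc)
  have "(\<lambda>N. (1 - a) * (\<Prod>n<N. 1 - (a * q) * q ^ n)) \<longlonglongrightarrow> (1 - a) * qpoch_inf (a * q) q"
    by (intro tendsto_intros qpoch_inf_LIMSEQ assms)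
  then show "(\<lambda>N. \<Prod>n<Suc N. 1 - a * q ^ n) \<longlonglongrightarrow> (1 - a) * qpoch_inf (a * q) q"
    by (simp only: prod.lessThan_Suc_shift) (simp add: mult.assoc)
qed

text \<open>The partial products of length \<open>N * k\<close> are sorted by the residue of the
  exponent modulo \<open>k\<close>; each residue class is a product with base
  \<open>q ^ k\<close>.\<close>

lemma qpoch_inf_split:
  assumes "norm q < 1" "k > 0"
  shows "qpoch_inf a q = (\<Prod>j<k. qpoch_inf (a * q ^ j) (q ^ k))"
proof (rule LIMSEQ_unique)
  have "strict_mono (\<lambda>N. N * k)"
    using assms(2) by (auto intro: strict_monoI)
  from LIMSEQ_subseq_LIMSEQ[OF qpoch_inf_LIMSEQ[OF assms(1)] this]
  show "(\<lambda>N. \<Prod>n<N * k. 1 - a * q ^ n) \<longlonglongrightarrow> qpoch_inf a q"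
    by (simp add: o_def)
  have qk: "norm (q ^ k) < 1"
    using assms by (simp add: norm_power power_less_one_iff)
  have "(\<Prod>n<N * k. 1 - a * q ^ n) = (\<Prod>j<k. \<Prod>n<N. 1 - a * q ^ j * (q ^ k) ^ n)" for N
  proof -
    have "(\<Prod>n<N * k. 1 - a * q ^ n) = (\<Prod>m<N. \<Prod>n=m*k..<m*k+k. 1 - a * q ^ n)"
      by (simp add: prod.nat_group)
    also have "\<dots> = (\<Prod>m<N. \<Prod>j<k. 1 - a * q ^ (j + m * k))"
    proof (rule prod.cong[OF refl])
      fix m
      show "(\<Prod>n=m*k..<m*k+k. 1 - a * q ^ n) = (\<Prod>j<k. 1 - a * q ^ (j + m * k))"
        using prod.shift_bounds_nat_ivl[of "\<lambda>n. 1 - a * q ^ n" 0 "m * k" k]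
        by (simp add: atLeast0LessThan add.commute)
    qed
    also have "\<dots> = (\<Prod>j<k. \<Prod>m<N. 1 - a * q ^ (j + m * k))"
      by (rule prod.swap)
    finally show ?thesis
      by (simp only: power_add power_mult[symmetric] mult.assoc) (simp add: mult.commute)
  qed
  then show "(\<lambda>N. \<Prod>n<N * k. 1 - a * q ^ n) \<longlonglongrightarrow> (\<Prod>j<k. qpoch_inf (a * q ^ j) (q ^ k))"
    by (simp only:) (intro tendsto_prod qpoch_inf_LIMSEQ qk)
qed

lemma qpoch_inf_mult_uminus:
  assumes "norm q < 1"
  shows "qpoch_inf a q * qpoch_inf (- a) q = qpoch_inf (a\<^sup>2) (q\<^sup>2)"
proof (rule LIMSEQ_unique)
  have "(\<lambda>N. (\<Prod>n<N. 1 - a * q ^ n) * (\<Prod>n<N. 1 - (- a) * q ^ n))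
          \<longlonglongrightarrow> qpoch_inf a q * qpoch_inf (- a) q"
    by (intro tendsto_intros qpoch_inf_LIMSEQ assms)
  moreover have "(1 - a * q ^ n) * (1 - (- a) * q ^ n) = 1 - a\<^sup>2 * (q\<^sup>2) ^ n" for n
    by (simp add: algebra_simps power2_eq_square power_mult_distrib)
  ultimately show "(\<lambda>N. \<Prod>n<N. 1 - a\<^sup>2 * (q\<^sup>2) ^ n) \<longlonglongrightarrow> qpoch_inf a q * qpoch_inf (- a) q"
    by (simp only: prod.distrib[symmetric])
  show "(\<lambda>N. \<Prod>n<N. 1 - a\<^sup>2 * (q\<^sup>2) ^ n) \<longlonglongrightarrow> qpoch_inf (a\<^sup>2) (q\<^sup>2)"
    by (intro qpoch_inf_LIMSEQ) (use assms in \<open>simp add: norm_power power_less_one_iff\<close>)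
qed

text \<open>Argument and base may both depend on \<open>z\<close>, since the nome will vary with the
  point of the upper half-plane. Comparison with a geometric series gives uniform convergence on
  closed balls.\<close>

lemma holomorphic_on_qpoch_inf:
  assumes "open S" and f: "f holomorphic_on S" and h: "h holomorphic_on S"
    and less: "\<And>z. z \<in> S \<Longrightarrow> norm (h z) < 1"
  shows "(\<lambda>z. qpoch_inf (f z) (h z)) holomorphic_on S"
proof (rule holomorphic_uniform_sequence[OF \<open>open S\<close>])
  show "(\<lambda>z. \<Prod>n<N. 1 - f z * h z ^ n) holomorphic_on S" for N
    using f h by (intro holomorphic_intros)
next
  fix x assume "x \<in> S"
  then obtain d where d: "d > 0" "cball x d \<subseteq> S"
    using \<open>open S\<close> open_contains_cball by blast
  let ?K = "cball x d"
  have cf: "continuous_on ?K f" and ch: "continuous_on ?K h"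
    using f h d(2) holomorphic_on_imp_continuous_on continuous_on_subset by blast+
  have "compact (f ` ?K)"
    by (intro compact_continuous_image cf) auto
  then obtain A where A: "\<And>z. z \<in> ?K \<Longrightarrow> norm (f z) \<le> A"
    using compact_imp_bounded bounded_iff by (metis imageI)
  have "continuous_on ?K (\<lambda>z. norm (h z))"
    by (intro continuous_intros ch)
  then obtain y where y: "y \<in> ?K" "\<And>z. z \<in> ?K \<Longrightarrow> norm (h z) \<le> norm (h y)"
    using continuous_attains_sup[of ?K "\<lambda>z. norm (h z)"] d(1) by auto
  \<comment> \<open>By compactness a single \<open>r\<close> below 1 bounds the base on the whole
    ball.\<close>
  define r where "r = norm (h y)"
  have r: "0 \<le> r" "r < 1"
    using less y(1) d(2) by (auto simp: r_def)
  have "uniformly_convergent_on ?K (\<lambda>N z. \<Sum>n<N. norm (- (f z * h z ^ n)))"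
  proof (rule Weierstrass_m_test')
    show "norm (norm (- (f z * h z ^ n))) \<le> A * r ^ n" if "z \<in> ?K" for n z
      using A[OF that] y(2)[OF that] norm_ge_zero[of "f z"]
      unfolding norm_minus_cancel norm_mult norm_power real_norm_def r_def
      by (simp add: abs_mult power_abs) (intro mult_mono power_mono, auto intro: order_trans[OF norm_ge_zero])
    show "summable (\<lambda>n. A * r ^ n)"
      using r by (intro summable_mult summable_geometric) auto
  qed
  then have "uniformly_convergent_on ?K (\<lambda>N z. \<Prod>n<N. 1 + - (f z * h z ^ n))"
    by (intro uniformly_convergent_on_prod continuous_intros cf ch) auto
  then obtain l where l: "uniform_limit ?K (\<lambda>N z. \<Prod>n<N. 1 - f z * h z ^ n) l sequentially"
    unfolding uniformly_convergent_on_def by auto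
  have "l z = qpoch_inf (f z) (h z)" if "z \<in> ?K" for z
    using LIMSEQ_unique[OF tendsto_uniform_limitI[OF l that] qpoch_inf_LIMSEQ] less that d(2) by blast
  then have "uniform_limit ?K (\<lambda>N z. \<Prod>n<N. 1 - f z * h z ^ n) (\<lambda>z. qpoch_inf (f z) (h z)) sequentially"
    using l uniform_limit_cong'[of ?K _ _ l] by (metis (no_types, lifting))
  with d show "\<exists>d>0. cball x d \<subseteq> S \<and>
      uniform_limit (cball x d) (\<lambda>N z. \<Prod>n<N. 1 - f z * h z ^ n) (\<lambda>z. qpoch_inf (f z) (h z)) sequentially"
    by blast
qed

section \<open>The theta function\<close>

text \<open>The quotient \<open>F / D\<close> is an entire elliptic function, hence constant.\<close>
lemma quasiperiodic_proportional:
  fixes F D :: "complex \<Rightarrow> complex" and t :: complex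
  assumes t: "Im t > 0"
    and F: "F holomorphic_on UNIV" and D: "D holomorphic_on UNIV"
    and zero: "\<And>z. D z = 0 \<Longrightarrow> F z = 0 \<and> deriv D z \<noteq> 0"
    and nz: "\<And>z. e1 z \<noteq> 0" "\<And>z. e2 z \<noteq> 0"
    and F1: "\<And>z. F (z + 1) = e1 z * F z" and D1: "\<And>z. D (z + 1) = e1 z * D z"
    and Ft: "\<And>z. F (z + t) = e2 z * F z" and Dt: "\<And>z. D (z + t) = e2 z * D z"
  obtains c where "\<And>z. F z = c * D z"
proof -
  define h where "h = remove_sings (\<lambda>z. F z / D z)"
  have F': "F analytic_on {z}" and D': "D analytic_on {z}" for z
    using F D by (auto intro: holomorphic_on_imp_analytic_at)
  have iso: "isolated_singularity_at (\<lambda>z. F z / D z) z" for z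
    by (intro meromorphic_on_isolated_singularity[of _ z] meromorphic_on_divide
          analytic_on_imp_meromorphic_on F' D')
  have lim: "\<exists>c. (\<lambda>z. F z / D z) \<midarrow>z\<rightarrow> c" for z
  proof (cases "D z = 0")
    case True
    \<comment> \<open>At a simple zero of \<open>D\<close>, where \<open>F\<close> vanishes too, the
      quotient equals a quotient of difference quotients and tends to the quotient of the
      derivatives.\<close>
    have dF: "(F has_field_derivative deriv F z) (at z)"
      and dD: "(D has_field_derivative deriv D z) (at z)"
      using F D by (auto intro!: holomorphic_derivI[of _ UNIV])
    have "(\<lambda>w. (F w - F z) / (w - z)) \<midarrow>z\<rightarrow> deriv F z"
         "(\<lambda>w. (D w - D z) / (w - z)) \<midarrow>z\<rightarrow> deriv D z"
      using dF dD by (simp_all add: has_field_derivative_iff)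
    then have "(\<lambda>w. ((F w - F z) / (w - z)) / ((D w - D z) / (w - z))) \<midarrow>z\<rightarrow> deriv F z / deriv D z"
      using zero[OF True] by (intro tendsto_divide) auto
    moreover have "eventually (\<lambda>w. ((F w - F z) / (w - z)) / ((D w - D z) / (w - z)) = F w / D w) (at z)"
      using eventually_neq_at_within[of z z UNIV]
      by eventually_elim (use True zero[OF True] in auto)
    ultimately have "(\<lambda>w. F w / D w) \<midarrow>z\<rightarrow> deriv F z / deriv D z"
      by (rule Lim_transform_eventually)
    then show ?thesis by blast
  next
    case False
    then have "(\<lambda>z. F z / D z) analytic_on {z}"
      by (intro analytic_intros F' D') auto
    then show ?thesis
      using analytic_at_imp_isCont isContD by blast
  qed
  have ana: "h analytic_on {z}" for z
    unfolding h_def using lim iso remove_sings_analytic_at by metis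
  then have "h analytic_on UNIV"
    using analytic_on_analytic_at by blast
  then have holh: "h holomorphic_on UNIV"
    by (simp add: analytic_imp_holomorphic)
  \<comment> \<open>Periodicity passes through limits, because \<open>h\<close> is determined by the
    limit of the quotient at each point.\<close>
  have per: "h (z + w) = h z" if "\<And>z. F (z + w) / D (z + w) = F z / D z" for z w
  proof -
    obtain c where c: "(\<lambda>u. F u / D u) \<midarrow>z\<rightarrow> c"
      using lim by blast
    have "(\<lambda>u. F (u + w) / D (u + w)) \<midarrow>z\<rightarrow> c"
      using c that by simp
    then have "(\<lambda>u. F u / D u) \<midarrow>z + w\<rightarrow> c"
      using LIM_offset[of "\<lambda>u. F (u + w) / D (u + w)" c z "- w"] by simp
    with c show ?thesis
      unfolding h_def by (metis remove_sings_eqI)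
  qed
  have h1: "h (z + 1) = h z" and ht: "h (z + t) = h z" for z
    by (rule per; simp add: F1 D1 Ft Dt nz)+
  have hn1: "h (z + of_nat n) = h z" and hnt: "h (z + of_nat n * t) = h z" for z n
    by (induction n arbitrary: z) (use h1 ht in \<open>simp_all add: algebra_simps, metis add.assoc add.commute, metis add.assoc add.commute\<close>)
  have hi1: "h (z + of_int n) = h z" for z n
    using hn1[of z "nat n"] hn1[of "z + of_int n" "nat (- n)"] by (cases "n \<ge> 0") auto
  have hit: "h (z + of_int n * t) = h z" for z n
    using hnt[of z "nat n"] hnt[of "z + of_int n * t" "nat (- n)"] by (cases "n \<ge> 0") auto
  \<comment> \<open>\<open>h\<close> takes all its values on this compact period parallelogram, so
    Liouville's theorem applies. Below, \<open>x\<close> and \<open>y\<close> are the real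
    coordinates of \<open>z\<close> in the basis 1, \<open>t\<close>.\<close>
  let ?par = "(\<lambda>(x, y). complex_of_real x + complex_of_real y * t) ` ({0..1} \<times> {0..1})"
  have "compact ?par"
    by (intro compact_continuous_image)
       (auto intro!: continuous_intros compact_Times simp: case_prod_beta)
  then have "compact (h ` ?par)"
    by (rule compact_continuous_image[rotated])
       (use holomorphic_on_imp_continuous_on[OF holh] in \<open>auto intro: continuous_on_subset\<close>)
  moreover have "range h \<subseteq> h ` ?par"
  proof safe
    fix z
    define y where "y = Im z / Im t"
    define x where "x = Re z - y * Re t"
    have z: "z = of_real x + of_real y * t"
      using t by (simp add: complex_eq_iff x_def y_def)
    have "h z = h (z + of_int (- \<lfloor>x\<rfloor>) + of_int (- \<lfloor>y\<rfloor>) * t)"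
      by (simp only: hi1 hit)
    also have "z + of_int (- \<lfloor>x\<rfloor>) + of_int (- \<lfloor>y\<rfloor>) * t = of_real (frac x) + of_real (frac y) * t"
      by (simp add: z frac_def algebra_simps)
    finally show "h z \<in> h ` ?par"
      by (auto intro!: image_eqI[of _ h] rev_image_eqI[of "(frac x, frac y)"]
               simp: frac_ge_0 less_imp_le[OF frac_lt_1])
  qed
  ultimately have "bounded (range h)"
    using bounded_subset compact_imp_bounded by blast
  then obtain c where c: "\<And>z. h z = c"
    using Liouville_theorem[OF holh] by (auto simp: constant_on_def)
  have "F z = c * D z" for z
  proof (cases "D z = 0")
    case True
    then show ?thesis using zero by simp
  next
    case False
    then have "(\<lambda>z. F z / D z) analytic_on {z}"
      by (intro analytic_intros F' D') auto
    then have "F z / D z = c"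
      using c[of z] unfolding h_def by simp
    with False show ?thesis by (simp add: field_simps)
  qed
  then show thesis using that by blast
qed

section \<open>The exponential \<open>qn\<close> and theta products: quasi-periods and zeros\<close>

lemma qn_add: "qn (z + w) = qn z * qn w"
  by (simp add: qn_def exp_add distrib_left)

lemma qn_diff: "qn (z - w) = qn z / qn w"
  by (simp add: qn_def exp_diff right_diff_distrib)

lemma qn_of_nat_mult: "qn (of_nat n * z) = qn z ^ n"
  unfolding qn_def exp_of_nat_mult[symmetric] by (simp add: mult_ac)

lemma qn_numeral_mult: "qn (numeral n * z) = qn z ^ numeral n"
  using qn_of_nat_mult[of "numeral n" z] by simp

lemma qn_nonzero [simp]: "qn z \<noteq> 0"
  by (simp add: qn_def)

lemma qn_1 [simp]: "qn 1 = 1"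
  by (simp add: qn_def exp_eq_1)

lemma qn_half [simp]: "qn (1/2) = - 1"
  by (simp add: qn_def)

lemma norm_qn_less_1_iff: "norm (qn z) < 1 \<longleftrightarrow> Im z > 0"
  by (simp add: qn_def zero_less_mult_iff)

lemma qn_eq_1_iff: "qn z = 1 \<longleftrightarrow> (\<exists>m::int. z = of_int m)"
proof
  assume "qn z = 1"
  then obtain n :: int where n: "Im z = 0" "2 * pi * Re z = of_int (2 * n) * pi"
    unfolding qn_def exp_eq_1 by auto
  then have "z = of_int n"
    by (simp add: complex_eq_iff)
  then show "\<exists>m::int. z = of_int m" ..
next
  assume "\<exists>m::int. z = of_int m"
  then show "qn z = 1" by (auto simp: qn_def exp_eq_1)
qed

lemma holomorphic_on_qn [holomorphic_intros]:
  "f holomorphic_on A \<Longrightarrow> (\<lambda>z. qn (f z)) holomorphic_on A"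
  unfolding qn_def by (intro holomorphic_intros)

text \<open>Up to a constant and a power of the nome, Jacobi's \<open>\<vartheta>\<^sub>1\<close> divided by \<open>(Q; Q)\<^sub>\<infinity>\<close>, where \<open>Q = qn t\<close>.\<close>
definition theta_prod :: "complex \<Rightarrow> complex \<Rightarrow> complex" where
  "theta_prod z t = (exp (- (pi * \<i> * z)) - exp (pi * \<i> * z)) *
     qpoch_inf (qn (t + z)) (qn t) * qpoch_inf (qn (t - z)) (qn t)"

text \<open>The factor \<open>1 - qn z\<close> is absorbed into the first product. This form
  displays the zeros and the behaviour under \<open>t\<close>; the definition displays oddness and
  the zero at 0.\<close>

lemma theta_prod_eq:
  assumes "Im t > 0"
  shows "theta_prod z t = exp (- (pi * \<i> * z)) * qpoch_inf (qn z) (qn t) * qpoch_inf (qn (t - z)) (qn t)"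
proof -
  have "qpoch_inf (qn z) (qn t) = (1 - qn z) * qpoch_inf (qn (t + z)) (qn t)"
    using qpoch_inf_step[of "qn t" "qn z"] assms by (simp add: norm_qn_less_1_iff qn_add mult.commute)
  moreover have "exp (- (pi * \<i> * z)) * (1 - qn z) = exp (- (pi * \<i> * z)) - exp (pi * \<i> * z)"
    by (simp add: qn_def right_diff_distrib exp_add[symmetric]) (simp add: mult_ac)
  ultimately show ?thesis
    by (simp add: theta_prod_def mult.assoc[symmetric])
qed

lemma theta_prod_minus: "theta_prod (- z) t = - theta_prod z t"
  by (simp add: theta_prod_def algebra_simps)

lemma theta_prod_0 [simp]: "theta_prod 0 t = 0"
  by (simp add: theta_prod_def)

lemma theta_prod_add_1: "theta_prod (z + 1) t = - theta_prod z t"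
proof -
  have "qn (t + (z + 1)) = qn (t + z)" "qn (t - (z + 1)) = qn (t - z)"
    by (simp_all add: qn_add qn_diff)
  moreover have "exp (- (pi * \<i> * (z + 1))) = - exp (- (pi * \<i> * z))"
       "exp (pi * \<i> * (z + 1)) = - exp (pi * \<i> * z)"
    by (simp_all add: exp_add exp_diff distrib_left exp_minus)
  ultimately show ?thesis
    by (simp only: theta_prod_def) (simp add: algebra_simps)
qed

text \<open>The shift removes \<open>1 - qn z\<close> from one product and adds
  \<open>1 - qn (- z)\<close> to the other; the ratio of these two factors is an exponential up to
  sign.\<close>

lemma theta_prod_add_period:
  assumes "Im t > 0"
  shows "theta_prod (z + t) t = - exp (- (pi * \<i> * (t + 2 * z))) * theta_prod z t"
proof -
  have "qpoch_inf (qn (- z)) (qn t) = (1 - qn (- z)) * qpoch_inf (qn (t - z)) (qn t)"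
    using qpoch_inf_step[of "qn t" "qn (- z)"] assms
    by (simp add: norm_qn_less_1_iff qn_add[symmetric])
  moreover have "exp (- (pi * \<i> * (z + t))) * (1 - qn (- z)) =
      - exp (- (pi * \<i> * (t + 2 * z))) * (exp (- (pi * \<i> * z)) - exp (pi * \<i> * z))"
    by (simp add: qn_def right_diff_distrib exp_add[symmetric]) (simp add: algebra_simps)
  moreover have "theta_prod (z + t) t =
      exp (- (pi * \<i> * (z + t))) * qpoch_inf (qn (t + z)) (qn t) * qpoch_inf (qn (- z)) (qn t)"
    by (subst theta_prod_eq[OF assms]) (simp add: add.commute)
  moreover have "x = - e' * (s * u * v)" if "p = w * v" "e * w = - e' * s" "x = e * u * p"
    for p w v e e' s u x :: complex
    using that by (metis (no_types, lifting) mult.assoc mult.left_commute)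
  ultimately show ?thesis
    unfolding theta_prod_def by blast
qed

text \<open>The two basic shifts are iterated; negative steps are read off from the positive case at
  the shifted point. The square in the exponent sums the linear exponents of the single steps, and
  the mixed term is an integral multiple of 2 pi i.\<close>

lemma theta_prod_lattice:
  fixes m n :: int
  assumes "Im t > 0"
  shows "theta_prod (z + of_int m + of_int n * t) t =
    exp (pi * \<i> * (of_int m + of_int n - of_int n ^ 2 * t - 2 * of_int n * z)) * theta_prod z t"
proof -
  have 1: "theta_prod (z + of_nat k) t = exp (pi * \<i> * of_nat k) * theta_prod z t" for k z
  proof (induction k)
    case (Suc k)
    have "theta_prod (z + of_nat (Suc k)) t = - theta_prod (z + of_nat k) t"
      using theta_prod_add_1[of "z + of_nat k" t] by (simp add: add_ac)
    then show ?case
      using Suc by (simp add: distrib_left exp_add)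
  qed simp
  have 1: "theta_prod (z + of_int m) t = exp (pi * \<i> * of_int m) * theta_prod z t" for z m
    using 1[of z "nat m"] 1[of "z + of_int m" "nat (- m)"]
    by (cases "m \<ge> 0") (simp_all add: exp_minus field_simps)
  have 2: "theta_prod (z + of_nat k * t) t =
      exp (pi * \<i> * (of_nat k - of_nat k ^ 2 * t - 2 * of_nat k * z)) * theta_prod z t" for k z
  proof (induction k)
    case (Suc k)
    have "theta_prod (z + of_nat (Suc k) * t) t
        = - exp (- (pi * \<i> * (t + 2 * (z + of_nat k * t)))) * theta_prod (z + of_nat k * t) t"
      using theta_prod_add_period[OF assms, of "z + of_nat k * t"] by (simp add: algebra_simps)
    also have "\<dots> = exp (pi * \<i>) * exp (- (pi * \<i> * (t + 2 * (z + of_nat k * t)))) * 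
       exp (pi * \<i> * (of_nat k - of_nat k ^ 2 * t - 2 * of_nat k * z)) * theta_prod z t"
      using Suc by simp
    also have "exp (pi * \<i>) * exp (- (pi * \<i> * (t + 2 * (z + of_nat k * t)))) * 
       exp (pi * \<i> * (of_nat k - of_nat k ^ 2 * t - 2 * of_nat k * z)) =
       exp (pi * \<i> * (of_nat (Suc k) - of_nat (Suc k) ^ 2 * t - 2 * of_nat (Suc k) * z))"
      unfolding exp_add[symmetric] by (rule arg_cong[of _ _ exp]) (simp add: algebra_simps power2_eq_square)
    finally show ?case .
  qed simp
  have 2: "theta_prod (z + of_int n * t) t =
      exp (pi * \<i> * (of_int n - of_int n ^ 2 * t - 2 * of_int n * z)) * theta_prod z t" for z n
  proof (cases "n \<ge> 0")
    case True
    then show ?thesis using 2[of z "nat n"] by simp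
  next
    case False
    then have "theta_prod z t =
        exp (pi * \<i> * (- of_int n - of_int n ^ 2 * t + 2 * of_int n * (z + of_int n * t))) *
          theta_prod (z + of_int n * t) t"
      using 2[of "z + of_int n * t" "nat (- n)"] by simp
    moreover have "exp (pi * \<i> * (of_int n - of_int n ^ 2 * t - 2 * of_int n * z)) *
        exp (pi * \<i> * (- of_int n - of_int n ^ 2 * t + 2 * of_int n * (z + of_int n * t))) = 1"
      unfolding exp_add[symmetric]
      by (simp add: algebra_simps power2_eq_square)
    moreover have "S = E1 * T" if "T = E2 * S" "E1 * E2 = 1" for S T E1 E2 :: complex
      using that by (simp add: mult.assoc[symmetric])
    ultimately show ?thesis by blast
  qed
  have "theta_prod (z + of_int m + of_int n * t) t =
     exp (pi * \<i> * (of_int n - of_int n ^ 2 * t - 2 * of_int n * z - 2 * of_int (n * m))) * 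
      (exp (pi * \<i> * of_int m) * theta_prod z t)"
    using 2[of "z + of_int m" n] 1[of z m] by (simp add: algebra_simps)
  also have "exp (pi * \<i> * (of_int n - of_int n ^ 2 * t - 2 * of_int n * z - 2 * of_int (n * m)))
      = exp (pi * \<i> * (of_int n - of_int n ^ 2 * t - 2 * of_int n * z))"
  proof -
    have "exp (pi * \<i> * (2 * of_int (n * m))) = 1"
      by (auto simp: exp_eq_1 intro!: exI[of _ "n * m"])
    then show ?thesis
      by (simp only: right_diff_distrib exp_diff) simp
  qed
  finally show ?thesis
    by (simp add: exp_add distrib_left right_diff_distrib exp_diff)
qed

lemma theta_prod_lattice_power2:
  fixes m n :: int
  assumes "Im t > 0"
  shows "theta_prod (z + of_int m + of_int n * t) t ^ 2 =
    exp (- (2 * pi * \<i> * (of_int n ^ 2 * t + 2 * of_int n * z))) * theta_prod z t ^ 2"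
proof -
  have "exp (pi * \<i> * (of_int m + of_int n - of_int n ^ 2 * t - 2 * of_int n * z)) ^ 2 =
      exp (2 * pi * \<i> * of_int (m + n)) * exp (- (2 * pi * \<i> * (of_int n ^ 2 * t + 2 * of_int n * z)))"
    unfolding exp_double[symmetric] exp_add[symmetric] by (rule arg_cong[of _ _ exp]) (simp add: algebra_simps)
  moreover have "exp (2 * pi * \<i> * of_int (m + n)) = 1"
    by (auto simp: exp_eq_1 intro!: exI[of _ "m + n"])
  ultimately show ?thesis
    by (simp only: theta_prod_lattice[OF assms] power_mult_distrib) simp
qed

lemma holomorphic_on_theta_prod:
  assumes "Im t > 0"
  shows "(\<lambda>z. theta_prod z t) holomorphic_on UNIV"
  unfolding theta_prod_def
  by (intro holomorphic_intros holomorphic_on_qpoch_inf) (use assms in \<open>auto simp: norm_qn_less_1_iff\<close>)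

lemma holomorphic_on_theta_prod' [holomorphic_intros]:
  assumes "Im t > 0" "f holomorphic_on A"
  shows "(\<lambda>z. theta_prod (f z) t) holomorphic_on A"
  using holomorphic_on_compose_gen[OF assms(2) holomorphic_on_theta_prod[OF assms(1)]]
  by (simp add: o_def)

text \<open>The product in \<open>qn z\<close> vanishes at the lattice points with coefficient of
  \<open>t\<close> at most 0, the product in \<open>qn (t - z)\<close> at those with coefficient at
  least 1.\<close>

lemma theta_prod_eq_0_iff:
  assumes "Im t > 0"
  shows "theta_prod z t = 0 \<longleftrightarrow> (\<exists>m n :: int. z = of_int m + of_int n * t)"
proof
  assume "\<exists>m n :: int. z = of_int m + of_int n * t"
  then show "theta_prod z t = 0"
    using theta_prod_lattice[OF assms, of 0] by auto
next
  assume "theta_prod z t = 0"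
  then consider "qpoch_inf (qn z) (qn t) = 0" | "qpoch_inf (qn (t - z)) (qn t) = 0"
    by (auto simp: theta_prod_eq[OF assms])
  then show "\<exists>m n :: int. z = of_int m + of_int n * t"
  proof cases
    case 1
    then obtain n where "qn z * qn t ^ n = 1"
      using assms by (auto simp: qpoch_inf_eq_0_iff norm_qn_less_1_iff)
    then have "qn (z + of_nat n * t) = 1"
      by (simp add: qn_add qn_of_nat_mult)
    then obtain m :: int where "z + of_nat n * t = of_int m"
      by (auto simp: qn_eq_1_iff)
    then have "z = of_int m + of_int (- int n) * t"
      by (simp add: algebra_simps)
    then show ?thesis by blast
  next
    case 2
    then obtain n where "qn (t - z) * qn t ^ n = 1"
      using assms by (auto simp: qpoch_inf_eq_0_iff norm_qn_less_1_iff)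
    then have "qn (t - z + of_nat n * t) = 1"
      by (simp add: qn_add qn_of_nat_mult)
    then obtain m :: int where "t - z + of_nat n * t = of_int m"
      by (auto simp: qn_eq_1_iff)
    then have "z = of_int (- m) + of_int (int n + 1) * t"
      by (simp add: algebra_simps)
    then show ?thesis by blast
  qed
qed

text \<open>Only the difference of exponentials vanishes at 0, so its derivative is multiplied by
  the value of the two infinite products there.\<close>

lemma has_field_derivative_theta_prod_0:
  assumes "Im t > 0"
  shows "((\<lambda>z. theta_prod z t) has_field_derivative
           - 2 * pi * \<i> * qpoch_inf (qn t) (qn t) ^ 2) (at 0)"
proof -
  define H where "H = (\<lambda>z. qpoch_inf (qn (t + z)) (qn t) * qpoch_inf (qn (t - z)) (qn t))"
  have "H holomorphic_on UNIV"
    unfolding H_def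
    by (intro holomorphic_intros holomorphic_on_qpoch_inf) (use assms in \<open>auto simp: norm_qn_less_1_iff\<close>)
  then have H: "(H has_field_derivative deriv H 0) (at 0)"
    by (auto intro!: holomorphic_derivI[of _ UNIV])
  have "((\<lambda>z. (exp (- (pi * \<i> * z)) - exp (pi * \<i> * z)) * H z) has_field_derivative
           - 2 * pi * \<i> * H 0) (at 0)"
    by (rule derivative_eq_intros H refl | simp add: algebra_simps)+
  then show ?thesis
    by (simp add: H_def theta_prod_def mult.assoc power2_eq_square)
qed

text \<open>All zeros are lattice translates of the simple zero at 0, and the multiplier is a
  nowhere vanishing exponential.\<close>

lemma deriv_theta_prod_nonzero:
  assumes "Im t > 0" "theta_prod z t = 0"
  shows "deriv (\<lambda>z. theta_prod z t) z \<noteq> 0"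
proof -
  obtain m n :: int where z: "z = of_int m + of_int n * t"
    using assms theta_prod_eq_0_iff by blast
  define e where "e = (\<lambda>w. exp (pi * \<i> * (of_int m + of_int n - of_int n ^ 2 * t - 2 * of_int n * w)))"
  define d where "d = - 2 * pi * \<i> * qpoch_inf (qn t) (qn t) ^ 2"
  have d: "d \<noteq> 0"
    using qpoch_inf_nonzero[of "qn t" "qn t"] assms by (simp add: d_def norm_qn_less_1_iff)
  have "(e has_field_derivative deriv e 0) (at 0)"
    unfolding e_def by (auto intro!: holomorphic_derivI[of _ UNIV] holomorphic_intros)
  from DERIV_mult[OF this has_field_derivative_theta_prod_0[OF assms(1)]]
  have "((\<lambda>w. e w * theta_prod w t) has_field_derivative e 0 * d) (at 0)"
    by (simp add: d_def mult_ac)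
  moreover have "(\<lambda>w. e w * theta_prod w t) = (\<lambda>w. theta_prod (w + z) t)"
    using theta_prod_lattice[OF assms(1), of _ m n] by (simp add: fun_eq_iff e_def z add_ac)
  ultimately have "((\<lambda>w. theta_prod (w + z) t) has_field_derivative e 0 * d) (at 0)"
    by simp
  then have "((\<lambda>w. theta_prod w t) has_field_derivative e 0 * d) (at z)"
    using DERIV_shift[of "\<lambda>w. theta_prod w t" "e 0 * d" 0 z] by (simp add: add.commute)
  then have "deriv (\<lambda>z. theta_prod z t) z = e 0 * d"
    by (rule DERIV_imp_deriv)
  with d show ?thesis by (simp add: e_def)
qed

section \<open>The three-term theta relation\<close>

lemma theta_prod_half_minus: "theta_prod (1/2 - z) t = theta_prod (z + 1/2) t"
  using theta_prod_minus[of "z - 1/2" t] theta_prod_add_1[of "z - 1/2" t] by (simp add: algebra_simps)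

text \<open>In \<open>z\<close> both sides have the same multipliers, and the left side vanishes at
  \<open>b\<close> and \<open>- b\<close>, hence at all lattice translates of these. The hypothesis
  on \<open>2 * b\<close> keeps the classes of \<open>b\<close> and \<open>- b\<close> apart, so the
  zeros of the product on the right are simple; the constant comes from
  \<open>z = 0\<close>.\<close>

lemma theta_prod_three_term:
  assumes t: "Im t > 0" and b: "theta_prod (2 * b) t \<noteq> 0"
  shows "theta_prod (z + 1/2) t ^ 2 * theta_prod b t ^ 2 - theta_prod (b + 1/2) t ^ 2 * theta_prod z t ^ 2
     = - (theta_prod (1/2) t ^ 2) * theta_prod (z + b) t * theta_prod (z - b) t"
proof -
  define L where "L = (\<lambda>z. theta_prod z t)"
  define F where "F = (\<lambda>z. L (z + 1/2) ^ 2 * L b ^ 2 - L (b + 1/2) ^ 2 * L z ^ 2)"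
  define D where "D = (\<lambda>z. L (z + b) * L (z - b))"
  have bL: "L b \<noteq> 0"
  proof
    assume "L b = 0"
    then obtain m n :: int where "b = of_int m + of_int n * t"
      using theta_prod_eq_0_iff[OF t] by (auto simp: L_def)
    then have "2 * b = of_int (2 * m) + of_int (2 * n) * t"
      by (simp add: algebra_simps)
    then show False using b theta_prod_eq_0_iff[OF t] by blast
  qed
  have F_lattice: "F (z + of_int m + of_int n * t) =
      exp (- (2 * pi * \<i> * (of_int n ^ 2 * t + 2 * of_int n * z))) * F z" for z and m n :: int
  proof -
    have "exp (- (2 * pi * \<i> * (of_int n ^ 2 * t + 2 * of_int n * (z + 1/2)))) =
       exp (- (2 * pi * \<i> * (of_int n ^ 2 * t + 2 * of_int n * z))) * exp (2 * pi * \<i> * of_int (- n))"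
      unfolding exp_add[symmetric] by (rule arg_cong[of _ _ exp]) (simp add: algebra_simps)
    also have "exp (2 * pi * \<i> * of_int (- n)) = 1"
      by (auto simp: exp_eq_1 intro!: exI[of _ "- n"])
    finally show ?thesis
      using theta_prod_lattice_power2[OF t, of z m n] theta_prod_lattice_power2[OF t, of "z + 1/2" m n]
      by (simp add: F_def L_def add_ac right_diff_distrib)
  qed
  have F_even: "F (- b) = 0" "F b = 0"
    using theta_prod_half_minus[of b t] theta_prod_minus[of b t] by (simp_all add: F_def L_def)
  have F_zero: "F z = 0" if "L (z + b) = 0 \<or> L (z - b) = 0" for z
  proof -
    from that obtain m n :: int where "z + b = of_int m + of_int n * t \<or> z - b = of_int m + of_int n * t"
      unfolding L_def theta_prod_eq_0_iff[OF t] by blast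
    then have "z = - b + of_int m + of_int n * t \<or> z = b + of_int m + of_int n * t"
      by (auto simp: algebra_simps)
    then show ?thesis using F_lattice[of "- b" m n] F_lattice[of b m n] F_even by auto
  qed
  have holL: "L holomorphic_on UNIV"
    unfolding L_def by (rule holomorphic_on_theta_prod[OF t])
  have dL: "(L has_field_derivative deriv L z) (at z)" for z
    by (rule holomorphic_derivI[OF holL]) auto
  have no_common: "\<not> (L (z + b) = 0 \<and> L (z - b) = 0)" for z
  proof
    assume "L (z + b) = 0 \<and> L (z - b) = 0"
    then obtain m n m' n' :: int where
      "z + b = of_int m + of_int n * t" "z - b = of_int m' + of_int n' * t"
      unfolding L_def theta_prod_eq_0_iff[OF t] by blast
    then have "2 * b = (of_int m + of_int n * t) - (of_int m' + of_int n' * t)"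
      by (metis add_diff_cancel_left' add_diff_eq diff_diff_eq2 mult_2)
    then have "2 * b = of_int (m - m') + of_int (n - n') * t"
      by (simp add: algebra_simps)
    then show False using b theta_prod_eq_0_iff[OF t] by blast
  qed
  have "\<exists>c. \<forall>z. F z = c * D z"
  proof (rule quasiperiodic_proportional[OF t, of F D "\<lambda>_. 1" "\<lambda>z. exp (- (2 * pi * \<i> * (t + 2 * z)))"])
    show "F holomorphic_on UNIV" "D holomorphic_on UNIV"
      unfolding F_def D_def L_def by (intro holomorphic_intros t)+
    show "F z = 0 \<and> deriv D z \<noteq> 0" if "D z = 0" for z
    proof
      from that have z: "L (z + b) = 0 \<or> L (z - b) = 0" by (simp add: D_def)
      then show "F z = 0" by (rule F_zero)
      have "(D has_field_derivative deriv L (z + b) * L (z - b) + deriv L (z - b) * L (z + b)) (at z)"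
        unfolding D_def
        by (intro DERIV_mult DERIV_shift[THEN iffD1] dL)
           (use dL[of "z - b"] DERIV_shift[of L _ z "- b"] in simp)
      then have "deriv D z = deriv L (z + b) * L (z - b) + deriv L (z - b) * L (z + b)"
        by (rule DERIV_imp_deriv)
      with z no_common[of z] deriv_theta_prod_nonzero[OF t] show "deriv D z \<noteq> 0"
        by (auto simp: L_def)
    qed
    show "F (z + 1) = 1 * F z" for z
      using F_lattice[of z 1 0] by simp
    show "F (z + t) = exp (- (2 * pi * \<i> * (t + 2 * z))) * F z" for z
      using F_lattice[of z 0 1] by simp
    show "D (z + 1) = 1 * D z" for z
      using theta_prod_add_1[of "z + b" t] theta_prod_add_1[of "z - b" t] by (simp add: D_def L_def algebra_simps)
    show "D (z + t) = exp (- (2 * pi * \<i> * (t + 2 * z))) * D z" for z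
    proof -
      have "exp (- (pi * \<i> * (t + 2 * (z + b)))) * exp (- (pi * \<i> * (t + 2 * (z - b)))) =
          exp (- (2 * pi * \<i> * (t + 2 * z)))"
        unfolding exp_add[symmetric] by (rule arg_cong[of _ _ exp]) (simp add: algebra_simps)
      moreover have "L (z + t + b) = - exp (- (pi * \<i> * (t + 2 * (z + b)))) * L (z + b)"
           "L (z + t - b) = - exp (- (pi * \<i> * (t + 2 * (z - b)))) * L (z - b)"
        using theta_prod_add_period[OF t, of "z + b"] theta_prod_add_period[OF t, of "z - b"]
        unfolding L_def by (simp_all add: add_ac add_diff_eq)
      ultimately show ?thesis
        by (simp add: D_def)
    qed
  qed auto
  then obtain c where c: "\<And>z. F z = c * D z" by blast
  have "L (1/2) ^ 2 * L b ^ 2 = - c * L b ^ 2"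
    using c[of 0] by (simp add: F_def D_def L_def theta_prod_minus power2_eq_square)
  then have "L (1/2) ^ 2 = - c" using bL by (metis mult_cancel_right power_not_zero)
  then have "c = - (L (1/2) ^ 2)" by simp
  then show ?thesis using c[of z] by (simp add: F_def D_def L_def)
qed

lemma exp_pi_i_half: "exp (pi * \<i> / 2) = \<i>"
  by (simp add: exp_eq_polar)

lemma Im_inversion_pos: "Im t > 0 \<Longrightarrow> Im (- 1 / t) > 0"
  by (simp add: Im_divide sum_power2_gt_zero_iff)

text \<open>Adding 1/2 to \<open>z\<close> changes the sign of \<open>qn z\<close> and divides the
  prefactor by \<i>, whence the \<i> on the right. With \<open>t = 5 * \<tau>\<close> and
  \<open>z\<close> equal to \<open>\<tau>\<close>, \<open>2 * \<tau>\<close> or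
  \<open>3 * \<tau>\<close> the left side is \<open>g1\<close> or \<open>g2\<close>.\<close>

lemma theta_prod_quotient:
  assumes "Im t > 0"
  shows "qpoch_inf (- qn z) (qn t) * qpoch_inf (- qn (t - z)) (qn t) /
     (qpoch_inf (qn z) (qn t) * qpoch_inf (qn (t - z)) (qn t)) =
     \<i> * theta_prod (z + 1/2) t / theta_prod z t"
proof -
  have "qn (z + 1/2) = - qn z" "qn (t - (z + 1/2)) = - qn (t - z)"
    by (simp_all only: qn_add qn_diff qn_half) (simp_all add: divide_simps)
  moreover have "exp (- (pi * \<i> * (z + 1/2))) = exp (- (pi * \<i> * z)) / exp (pi * \<i> / 2)"
    unfolding exp_diff[symmetric] by (simp add: algebra_simps)
  ultimately show ?thesis
    by (simp add: theta_prod_eq[OF assms] exp_pi_i_half)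
qed

section \<open>The algebraic relation between \<open>g1\<close> and \<open>g2\<close>\<close>

text \<open>The eta function without its factor q^(1/24), written in the nome so that it can be
  taken at powers of \<open>qn \<tau>\<close>.\<close>

definition euler_prod :: "complex \<Rightarrow> complex" where
  "euler_prod q = qpoch_inf q q"

lemma euler_prod_nonzero: "norm q < 1 \<Longrightarrow> euler_prod q \<noteq> 0"
  by (simp add: euler_prod_def qpoch_inf_nonzero)

lemma euler_prod_mult_neg:
  assumes "norm q < 1"
  shows "euler_prod q * qpoch_inf (- q) q = euler_prod (q\<^sup>2)"
  using qpoch_inf_mult_uminus[OF assms, of q] by (simp add: euler_prod_def)

lemma euler_prod_split2:
  assumes "norm q < 1"
  shows "euler_prod q = qpoch_inf q (q\<^sup>2) * euler_prod (q\<^sup>2)"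
  using qpoch_inf_split[OF assms, of 2 q] by (simp add: euler_prod_def numeral_2_eq_2)

lemma qpoch_inf_split5:
  assumes "norm q < 1"
  shows "qpoch_inf (c * q) q = qpoch_inf (c * q) (q^5) * qpoch_inf (c * q^2) (q^5) *
    qpoch_inf (c * q^3) (q^5) * qpoch_inf (c * q^4) (q^5) * qpoch_inf (c * q^5) (q^5)"
  using qpoch_inf_split[OF assms, of 5 "c * q"]
  by (simp add: eval_nat_numeral mult.assoc)

text \<open>The powers of q^(1/24) cancel since 2 * 2 + 5 * 4 = 4 * 1 + 10 * 2.\<close>

lemma g_eq_euler_prod:
  "g \<tau> = euler_prod (qn \<tau> ^ 2) ^ 2 * euler_prod (qn \<tau> ^ 5) ^ 4 /
          (euler_prod (qn \<tau>) ^ 4 * euler_prod (qn \<tau> ^ 10) ^ 2)"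
proof -
  define e where "e = exp (2 * pi * \<i> * \<tau> / 24)"
  have e: "exp (2 * pi * \<i> * (of_nat n * \<tau>) / 24) = e ^ n" for n
    unfolding e_def exp_of_nat_mult[symmetric] by (simp add: mult_ac)
  have eta: "dedekind_eta (of_nat n * \<tau>) = e ^ n * euler_prod (qn \<tau> ^ n)" for n
    by (simp only: dedekind_eta_def euler_prod_def qn_of_nat_mult e)
  have "e \<noteq> 0" by (simp add: e_def)
  then show ?thesis
    using eta[of 1] eta[of 2] eta[of 5] eta[of 10]
    by (simp add: g_def power_mult_distrib power_mult[symmetric] field_simps)
qed

text \<open>Together \<open>g1\<close> and \<open>g2\<close> cover the residues 1, 2, 3, 4 modulo 5.
  Supplying the residue 0 gives (-q; q)(q^5; q^5) / ((q; q)(-q^5; q^5)), and (-q; q) = (q^2; q^2) /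
  (q; q) turns this into the eta quotient whose square is \<open>g\<close>.\<close>

lemma g_eq_product:
  assumes "Im \<tau> > 0"
  shows "g \<tau> = (g1 \<tau> * g2 \<tau>) ^ 2"
proof -
  define q where "q = qn \<tau>"
  have q: "norm q < 1" using assms by (simp add: q_def norm_qn_less_1_iff)
  then have qk: "norm (q ^ k) < 1" if "k > 0" for k
    using that by (simp add: norm_power power_less_one_iff)
  have qk': "norm (- (q ^ k)) < 1" if "k > 0" for k
    using qk[OF that] by simp
  note nz = qpoch_inf_nonzero[OF qk qk] qpoch_inf_nonzero[OF qk qk'] 
    qpoch_inf_nonzero[OF qk[of 5] q] qpoch_inf_nonzero[OF qk[of 5], of "- q"]
  have "g1 \<tau> * g2 \<tau> * (qpoch_inf (-1 * q^5) (q^5) * qpoch_inf (1 * q) q) =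
     qpoch_inf (1 * q^5) (q^5) * qpoch_inf (-1 * q) q"
    unfolding g1_def g2_def Let_def q_def[symmetric]
    apply (subst (1 2) qpoch_inf_split5[OF q])
    using nz q by (simp add: field_simps)
  then have A: "g1 \<tau> * g2 \<tau> * (qpoch_inf (- (q^5)) (q^5) * euler_prod q) = euler_prod (q^5) * qpoch_inf (- q) q"
    by (simp add: euler_prod_def)
  have B: "euler_prod q * qpoch_inf (- q) q = euler_prod (q^2)"
    "euler_prod (q^5) * qpoch_inf (- (q^5)) (q^5) = euler_prod (q^10)"
    using euler_prod_mult_neg[OF q] euler_prod_mult_neg[OF qk[of 5]] by (simp_all add: power_mult[symmetric])
  have nz': "euler_prod q \<noteq> 0" "euler_prod (q^5) \<noteq> 0" "euler_prod (q^10) \<noteq> 0"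
    using euler_prod_nonzero q qk by auto
  have "g1 \<tau> * g2 \<tau> * (euler_prod q ^ 2 * euler_prod (q^10)) = 
    (g1 \<tau> * g2 \<tau> * (qpoch_inf (- (q^5)) (q^5) * euler_prod q)) * euler_prod q * euler_prod (q^5)"
    by (simp add: B(2)[symmetric] power2_eq_square)
  also have "\<dots> = euler_prod (q^2) * euler_prod (q^5) ^ 2"
    unfolding A B(1)[symmetric] by (simp add: power2_eq_square)
  finally have "g1 \<tau> * g2 \<tau> = euler_prod (q^2) * euler_prod (q^5) ^ 2 / (euler_prod q ^ 2 * euler_prod (q^10))"
    using nz' by (simp add: field_simps)
  then show ?thesis
    by (simp add: g_eq_euler_prod q_def[symmetric] power_mult_distrib power_divide power_mult[symmetric])
qed

lemma g_nonzero:
  assumes "Im \<tau> > 0"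
  shows "g \<tau> \<noteq> 0"
proof -
  have "norm (qn \<tau>) < 1" using assms by (simp add: norm_qn_less_1_iff)
  then show ?thesis
    by (auto simp: g_eq_euler_prod norm_power power_less_one_iff intro!: euler_prod_nonzero)
qed

theorem g1_g2_relation:
  assumes "Im \<tau> > 0"
  shows "g1 \<tau> ^ 4 + g2 \<tau> ^ 4 = 1 / g \<tau> - 2 + 3 * g \<tau>"
proof -
  define t where "t = 5 * \<tau>"
  have t: "Im t > 0" using assms by (simp add: t_def)
  define L where "L = (\<lambda>z. theta_prod z t)"
  \<comment> \<open>Comparing imaginary parts, \<open>of_nat k * \<tau>\<close> in the lattice
    spanned by 1 and \<open>5 * \<tau>\<close> would force 5 to divide \<open>k\<close>.\<close>
  have nz: "L (of_nat k * \<tau>) \<noteq> 0" if "0 < k" "k < 5" for k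
  proof
    assume "L (of_nat k * \<tau>) = 0"
    then obtain m n :: int where "of_nat k * \<tau> = of_int m + of_int n * t"
      using theta_prod_eq_0_iff[OF t] by (auto simp: L_def)
    then have "Im (of_nat k * \<tau>) = Im (of_int m + of_int n * t)" by simp
    then have "(real k - real_of_int (5 * n)) * Im \<tau> = 0" by (simp add: t_def algebra_simps)
    then have "real k = real_of_int (5 * n)" using assms by simp
    then have "int k = 5 * n" by linarith
    with that show False by presburger
  qed
  have nz1: "L \<tau> \<noteq> 0" "L (2 * \<tau>) \<noteq> 0" "L (3 * \<tau>) \<noteq> 0"
    using nz[of 1] nz[of 2] nz[of 3] by simp_all
  have q: "qn t = qn \<tau> ^ 5" "qn (t - \<tau>) = qn \<tau> ^ 4" "qn (t - 2 * \<tau>) = qn \<tau> ^ 3" "qn (t - 3 * \<tau>) = qn \<tau> ^ 2"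
    "qn (2 * \<tau>) = qn \<tau> ^ 2" "qn (3 * \<tau>) = qn \<tau> ^ 3"
    unfolding t_def by (simp_all add: qn_numeral_mult[symmetric])
  have r: "g1 \<tau> = \<i> * L (\<tau> + 1/2) / L \<tau>" "g2 \<tau> = \<i> * L (2 * \<tau> + 1/2) / L (2 * \<tau>)"
    "g2 \<tau> = \<i> * L (3 * \<tau> + 1/2) / L (3 * \<tau>)"
    using theta_prod_quotient[OF t, of \<tau>] theta_prod_quotient[OF t, of "2 * \<tau>"] theta_prod_quotient[OF t, of "3 * \<tau>"]
    unfolding q by (simp_all add: g1_def g2_def Let_def L_def mult.commute)
  define r1 where "r1 = L (\<tau> + 1/2) / L \<tau>"
  define r2 where "r2 = L (2 * \<tau> + 1/2) / L (2 * \<tau>)"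
  \<comment> \<open>\<open>2 * \<tau>\<close> and \<open>3 * \<tau>\<close> add up to
    \<open>t\<close>, so both ratios express \<open>g2\<close>.\<close>
  have r3: "L (3 * \<tau> + 1/2) / L (3 * \<tau>) = r2"
    using r(2,3) by (simp add: r2_def flip: times_divide_eq_right)
  have three: "L (z + 1/2) ^ 2 * L \<tau> ^ 2 - L (\<tau> + 1/2) ^ 2 * L z ^ 2 =
      - (L (1/2) ^ 2) * L (z + \<tau>) * L (z - \<tau>)" for z
    using theta_prod_three_term[OF t, of \<tau> z] nz1(2) by (simp add: L_def)
  \<comment> \<open>The three-term relation is used at \<open>2 * \<tau>\<close> and at
    \<open>2 * \<tau> + 1/2\<close>; the second half shift only produces a sign, which squaring
    removes.\<close>
  have "L (2 * \<tau> + 1/2 + 1/2) = - L (2 * \<tau>)"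
    using theta_prod_add_1[of "2 * \<tau>" t] by (simp add: L_def add.assoc)
  then have e2: "L (2 * \<tau>) ^ 2 * L \<tau> ^ 2 - L (\<tau> + 1/2) ^ 2 * L (2 * \<tau> + 1/2) ^ 2 =
      - (L (1/2) ^ 2) * L (3 * \<tau> + 1/2) * L (\<tau> + 1/2)"
    using three[of "2 * \<tau> + 1/2"] by (simp add: algebra_simps)
  have e1: "L (2 * \<tau> + 1/2) ^ 2 * L \<tau> ^ 2 - L (\<tau> + 1/2) ^ 2 * L (2 * \<tau>) ^ 2 =
      - (L (1/2) ^ 2) * L (3 * \<tau>) * L \<tau>"
    using three[of "2 * \<tau>"] by (simp add: algebra_simps)
  have L: "L (\<tau> + 1/2) = r1 * L \<tau>" "L (2 * \<tau> + 1/2) = r2 * L (2 * \<tau>)" "L (3 * \<tau> + 1/2) = r2 * L (3 * \<tau>)"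
    using nz1 r3 by (simp_all add: r1_def r2_def field_simps)
  \<comment> \<open>The common factor \<open>L (1/2) ^ 2 * L (3 * \<tau>) * L \<tau>\<close> of the
    two right sides is eliminated.\<close>
  have "(L (2 * \<tau>) * L \<tau>) ^ 2 * (1 - r1^2 * r2^2) = (L (2 * \<tau>) * L \<tau>) ^ 2 * ((r2^2 - r1^2) * r1 * r2)"
    using e1 e2 unfolding L by algebra
  then have key: "1 - r1^2 * r2^2 = (r2^2 - r1^2) * r1 * r2"
    using nz1 by simp
  have g12: "g1 \<tau> = \<i> * r1" "g2 \<tau> = \<i> * r2"
    by (simp_all add: r r1_def r2_def)
  have gr: "g \<tau> = r1^2 * r2^2"
    using g_eq_product[OF assms] by (simp add: g12 power_mult_distrib)
  \<comment> \<open>The square of \<open>key\<close> reads (1 - g)^2 = g (r1^4 + r2^4 - 2 g), and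
    \<i>^4 = 1 turns \<open>r1\<close>, \<open>r2\<close> back into \<open>g1\<close>,
    \<open>g2\<close>.\<close>
  have "g \<tau> * (r1^4 + r2^4) = 1 - 2 * g \<tau> + 3 * g \<tau> ^ 2"
    using key unfolding gr by algebra
  then show ?thesis
    using g_nonzero[OF assms] by (simp add: g12 power_mult_distrib field_simps power2_eq_square)
qed

section \<open>Squares of theta constants\<close>

text \<open>These are the squares of Jacobi's theta constants for the nome exp(pi i t), in product
  form. Squares have weight one, so no branch of a square root enters the inversion
  formulas.\<close>

definition theta2_sq :: "complex \<Rightarrow> complex" where
  "theta2_sq t = 4 * exp (pi * \<i> * t / 2) * euler_prod (qn t) ^ 2 * qpoch_inf (- qn t) (qn t) ^ 4"

definition theta3_sq :: "complex \<Rightarrow> complex" where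
  "theta3_sq t = euler_prod (qn t) ^ 2 * qpoch_inf (- qn (t/2)) (qn t) ^ 4"

definition theta4_sq :: "complex \<Rightarrow> complex" where
  "theta4_sq t = euler_prod (qn t) ^ 2 * qpoch_inf (qn (t/2)) (qn t) ^ 4"

lemma theta2_sq_add_1: "theta2_sq (t + 1) = \<i> * theta2_sq t"
  by (simp add: theta2_sq_def qn_add distrib_left add_divide_distrib exp_add exp_pi_i_half)

lemma theta3_sq_add_1: "theta3_sq (t + 1) = theta4_sq t"
  unfolding theta3_sq_def theta4_sq_def add_divide_distrib qn_add qn_half by simp

lemma theta4_sq_add_1: "theta4_sq (t + 1) = theta3_sq t"
  unfolding theta3_sq_def theta4_sq_def add_divide_distrib qn_add qn_half by simp

text \<open>Splitting (q; q) into odd and even powers shows that theta_4 at \<open>2 * z\<close> is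
  (q; q)^2 / (q^2; q^2) for q = \<open>qn z\<close>; this is used at \<open>5 * \<tau>\<close> and
  at \<open>\<tau>\<close>.\<close>

lemma g_eq_theta4_sq:
  assumes "Im \<tau> > 0"
  shows "g \<tau> = theta4_sq (10 * \<tau>) / theta4_sq (2 * \<tau>)"
proof -
  have q: "norm (qn \<tau>) < 1" "norm (qn \<tau> ^ 5) < 1"
    using assms by (simp_all add: norm_qn_less_1_iff norm_power power_less_one_iff)
  have *: "theta4_sq (2 * z) = euler_prod (qn z) ^ 4 / euler_prod (qn z ^ 2) ^ 2" if "Im z > 0" for z
  proof -
    have z: "norm (qn z) < 1" using that by (simp add: norm_qn_less_1_iff)
    then have "euler_prod (qn z ^ 2) \<noteq> 0"
      by (intro euler_prod_nonzero) (simp add: norm_power power_less_one_iff)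
    then show ?thesis
      by (simp only: theta4_sq_def qn_numeral_mult euler_prod_split2[OF z] power_mult_distrib)
         (simp add: field_simps qn_numeral_mult[symmetric] flip: power_add)
  qed
  have "theta4_sq (10 * \<tau>) = euler_prod (qn \<tau> ^ 5) ^ 4 / euler_prod (qn \<tau> ^ 10) ^ 2"
    using *[of "5 * \<tau>"] assms by (simp add: qn_numeral_mult power_mult[symmetric])
  then show ?thesis
    using *[OF assms] by (simp add: g_eq_euler_prod mult.commute)
qed

section \<open>Inversion formulas\<close>

text \<open>Division by \<open>t\<close> carries the lattice of 1, \<open>t\<close> to that of 1,
  \<open>- 1 / t\<close>, and the Gaussian factor compensates the difference of the
  multipliers.\<close>

lemma theta_prod_inversion:
  assumes t: "Im t > 0"
  obtains K where "\<And>z. theta_prod (z / t) (- 1 / t) = K * exp (pi * \<i> * z ^ 2 / t) * theta_prod z t"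
proof -
  define t' where "t' = - 1 / t"
  have t0: "t \<noteq> 0" using t by auto
  have t': "Im t' > 0" using Im_inversion_pos[OF t] by (simp add: t'_def)
  define F where "F = (\<lambda>z. exp (- (pi * \<i> * z ^ 2 / t)) * theta_prod (z / t) t')"
  have "\<exists>c. \<forall>z. F z = c * theta_prod z t"
  proof (rule quasiperiodic_proportional[OF t, of F "\<lambda>z. theta_prod z t" "\<lambda>_. - 1" "\<lambda>z. - exp (- (pi * \<i> * (t + 2 * z)))"])
    show "F holomorphic_on UNIV"
      unfolding F_def by (intro holomorphic_intros t') (use t0 in auto)
    show "(\<lambda>z. theta_prod z t) holomorphic_on UNIV"
      by (rule holomorphic_on_theta_prod[OF t])
    show "F z = 0 \<and> deriv (\<lambda>z. theta_prod z t) z \<noteq> 0" if z: "theta_prod z t = 0" for z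
    proof
      obtain m n :: int where "z = of_int m + of_int n * t"
        using z theta_prod_eq_0_iff[OF t] by blast
      then have "z / t = of_int n + of_int (- m) * t'"
        using t0 by (simp add: t'_def field_simps)
      then show "F z = 0"
        unfolding F_def using theta_prod_eq_0_iff[OF t'] by (metis mult_zero_right)
    qed (rule deriv_theta_prod_nonzero[OF t z])
    show "theta_prod (z + 1) t = - 1 * theta_prod z t" for z
      by (simp add: theta_prod_add_1)
    show "theta_prod (z + t) t = - exp (- (pi * \<i> * (t + 2 * z))) * theta_prod z t" for z
      by (rule theta_prod_add_period[OF t])
    show "F (z + 1) = - 1 * F z" for z
    proof -
      have "theta_prod ((z + 1) / t) t' = exp (pi * \<i> * (- 1 - t' + 2 * (z / t))) * theta_prod (z / t) t'"
        using theta_prod_lattice[OF t', of "z / t" 0 "- 1"] by (simp add: t'_def add_divide_distrib)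
      moreover have "exp (- (pi * \<i> * (z + 1) ^ 2 / t)) * exp (pi * \<i> * (- 1 - t' + 2 * (z / t))) =
          exp (- (pi * \<i> * z ^ 2 / t)) * exp (- (pi * \<i>))"
        unfolding exp_add[symmetric]
        by (rule arg_cong[of _ _ exp]) (use t0 in \<open>simp add: t'_def field_simps power2_eq_square\<close>)
      ultimately show ?thesis
        by (simp add: F_def exp_minus mult.assoc[symmetric])
    qed
    show "F (z + t) = - exp (- (pi * \<i> * (t + 2 * z))) * F z" for z
    proof -
      have "theta_prod ((z + t) / t) t' = - theta_prod (z / t) t'"
        using theta_prod_add_1[of "z / t" t'] t0 by (simp add: add_divide_distrib)
      moreover have "exp (- (pi * \<i> * (z + t) ^ 2 / t)) =
          exp (- (pi * \<i> * (t + 2 * z))) * exp (- (pi * \<i> * z ^ 2 / t))"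
        unfolding exp_add[symmetric]
        by (rule arg_cong[of _ _ exp]) (use t0 in \<open>simp add: field_simps power2_eq_square\<close>)
      ultimately show ?thesis
        by (simp add: F_def)
    qed
  qed auto
  then obtain K where K: "\<And>z. F z = K * theta_prod z t" by blast
  have "theta_prod (z / t) (- 1 / t) = K * exp (pi * \<i> * z ^ 2 / t) * theta_prod z t" for z
  proof -
    have "theta_prod (z / t) t' = exp (pi * \<i> * z ^ 2 / t) * F z"
      by (simp add: F_def mult.assoc[symmetric] exp_add[symmetric])
    then show ?thesis by (simp add: K t'_def)
  qed
  then show thesis using that by blast
qed

text \<open>Euler's identity (Q; Q^2)(-Q; Q) = 1 with Q = \<open>qn t\<close>, the first factor
  being split over the two square roots of Q.\<close>

lemma half_period_products:
  assumes "Im t > 0"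
  shows "qpoch_inf (qn (t/2)) (qn t) * qpoch_inf (- qn (t/2)) (qn t) * qpoch_inf (- qn t) (qn t) = 1"
proof -
  have q: "norm (qn t) < 1" "norm (qn t ^ 2) < 1"
    using assms by (simp_all add: norm_qn_less_1_iff norm_power power_less_one_iff)
  have "qn (t/2) ^ 2 = qn t"
    using qn_numeral_mult[of "num.Bit0 num.One" "t/2"] by simp
  then have "qpoch_inf (qn (t/2)) (qn t) * qpoch_inf (- qn (t/2)) (qn t) = qpoch_inf (qn t) (qn t ^ 2)"
    using qpoch_inf_mult_uminus[OF q(1), of "qn (t/2)"] by simp
  moreover have "qpoch_inf (qn t) (qn t ^ 2) * euler_prod (qn t ^ 2) * qpoch_inf (- qn t) (qn t) = euler_prod (qn t ^ 2)"
    using euler_prod_split2[OF q(1)] euler_prod_mult_neg[OF q(1)] by simp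
  ultimately show ?thesis
    using euler_prod_nonzero[OF q(2)] by (simp add: mult_ac)
qed

text \<open>Up to elementary factors these are Jacobi's constants theta_2, theta_4, theta_3 divided
  by \<open>euler_prod (qn t)\<close>.\<close>

lemma theta_prod_half_periods:
  assumes "Im t > 0"
  shows "theta_prod (1/2) t = - 2 * \<i> * qpoch_inf (- qn t) (qn t) ^ 2"
    and "theta_prod (t/2) t = exp (- (pi * \<i> * t / 2)) * qpoch_inf (qn (t/2)) (qn t) ^ 2"
    and "theta_prod (t/2 + 1/2) t = - \<i> * exp (- (pi * \<i> * t / 2)) * qpoch_inf (- qn (t/2)) (qn t) ^ 2"
proof -
  have "qn (t + 1/2) = - qn t" "qn (t - 1/2) = - qn t"
    by (simp_all only: qn_add qn_diff qn_half) simp_all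
  moreover have "exp (- (pi * \<i> / 2)) = - \<i>"
    by (simp add: exp_minus exp_pi_i_half)
  ultimately show "theta_prod (1/2) t = - 2 * \<i> * qpoch_inf (- qn t) (qn t) ^ 2"
    by (simp add: theta_prod_def power2_eq_square exp_pi_i_half)
  show "theta_prod (t/2) t = exp (- (pi * \<i> * t / 2)) * qpoch_inf (qn (t/2)) (qn t) ^ 2"
    by (simp add: theta_prod_eq[OF assms] power2_eq_square)
  have "qn (t/2 + 1/2) = - qn (t/2)" "qn (t - (t/2 + 1/2)) = - qn (t/2)"
    by (simp_all only: qn_add qn_diff qn_half) 
       (simp_all add: divide_simps, simp flip: qn_add)
  moreover have "exp (- (pi * \<i> * (t/2 + 1/2))) = exp (- (pi * \<i> * t / 2)) / exp (pi * \<i> / 2)"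
    unfolding exp_diff[symmetric] by (rule arg_cong[of _ _ exp]) (simp add: algebra_simps)
  ultimately show "theta_prod (t/2 + 1/2) t = - \<i> * exp (- (pi * \<i> * t / 2)) * qpoch_inf (- qn (t/2)) (qn t) ^ 2"
    by (simp add: theta_prod_eq[OF assms] power2_eq_square exp_pi_i_half)
qed

text \<open>\<open>\<vartheta>\<^sub>4\<^sup>2\<close> and \<open>\<vartheta>\<^sub>2\<^sup>2\<close> are cubic in \<open>theta_prod\<close> (one derivative at \<open>0\<close>, two half-period values), so only
  the cube of the constant \<open>K\<close> of the inversion formula matters; it is read off by multiplying
  the inversion formula over the three half-periods.\<close>
lemma theta4_sq_inversion:
  assumes t: "Im t > 0"
  shows "theta4_sq (- 1 / t) = - \<i> * t * theta2_sq t"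
proof -
  define t' where "t' = - 1 / t"
  have t0: "t \<noteq> 0" using t by auto
  have t': "Im t' > 0" using Im_inversion_pos[OF t] by (simp add: t'_def)
  obtain K where K: "\<And>z. theta_prod (z / t) t' = K * exp (pi * \<i> * z ^ 2 / t) * theta_prod z t"
    using theta_prod_inversion[OF t] unfolding t'_def by blast
  \<comment> \<open>\<open>x\<close> and \<open>y\<close> are the values of the Gaussian factor at
    \<open>t/2\<close> and at \<open>1/2\<close>.\<close>
  define x where "x = exp (pi * \<i> * t / 4)"
  define y where "y = exp (pi * \<i> / (4 * t))"
  have xy: "x \<noteq> 0" "y \<noteq> 0" by (simp_all add: x_def y_def)
  have x2: "exp (- (pi * \<i> * t / 2)) = 1 / x ^ 2" "exp (pi * \<i> * t / 2) = x ^ 2"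
    unfolding x_def exp_double[symmetric] by (simp_all add: exp_minus inverse_eq_divide mult_ac)
  have y2: "exp (- (pi * \<i> * t' / 2)) = y ^ 2"
    unfolding y_def exp_double[symmetric] t'_def by (simp add: mult_ac)
  define a where "a = qpoch_inf (- qn t) (qn t)"
  define b where "b = qpoch_inf (qn (t/2)) (qn t)"
  define c where "c = qpoch_inf (- qn (t/2)) (qn t)"
  define a' where "a' = qpoch_inf (- qn t') (qn t')"
  define b' where "b' = qpoch_inf (qn (t'/2)) (qn t')"
  define c' where "c' = qpoch_inf (- qn (t'/2)) (qn t')"
  define e where "e = euler_prod (qn t)"
  define e' where "e' = euler_prod (qn t')"
  have abc: "b * c * a = 1" "b' * c' * a' = 1"
    using half_period_products[OF t] half_period_products[OF t']
    by (simp_all add: a_def b_def c_def a'_def b'_def c'_def)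
  note L = theta_prod_half_periods[OF t, folded a_def b_def c_def, unfolded x2]
  note L' = theta_prod_half_periods[OF t', folded a'_def b'_def c'_def, unfolded y2]
  \<comment> \<open>Division by \<open>t\<close> sends the half-periods \<open>t/2\<close>,
    \<open>1/2\<close>, \<open>t/2 + 1/2\<close> to \<open>1/2\<close>, \<open>- t'/2\<close>,
    \<open>1/2 - t'/2\<close>; relations 1, 2, 3 are the inversion formula at these points.\<close>
  have "exp (pi * \<i> * (t/2) ^ 2 / t) = x"
    using t0 by (simp add: x_def power2_eq_square mult.assoc)
  then have 1: "- 2 * \<i> * a' ^ 2 * x = K * b ^ 2"
    using K[of "t/2"] L(2) L'(1) t0 xy by (simp add: field_simps power2_eq_square)
  have "exp (pi * \<i> * (1/2) ^ 2 / t) = y"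
    by (simp add: y_def power2_eq_square)
  moreover have "theta_prod ((1/2) / t) t' = - theta_prod (t'/2) t'"
    using theta_prod_minus[of "t'/2" t'] by (simp add: t'_def mult.commute)
  ultimately have "y * (y * b' ^ 2) = y * (2 * \<i> * K * a ^ 2)"
    using K[of "1/2"] L(1) L'(2) by (simp add: algebra_simps power2_eq_square)
  then have 2: "y * b' ^ 2 = 2 * \<i> * K * a ^ 2" using xy by simp
  have "exp (pi * \<i> * (t/2 + 1/2) ^ 2 / t) = exp (pi * \<i> * t / 4 + (pi * \<i> / 2 + pi * \<i> / (4 * t)))"
    by (rule arg_cong[of _ _ exp]) (use t0 in \<open>simp add: field_simps power2_eq_square\<close>)
  also have "\<dots> = x * (\<i> * y)"
    by (simp add: exp_add x_def y_def exp_pi_i_half)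
  finally have "exp (pi * \<i> * (t/2 + 1/2) ^ 2 / t) = x * (\<i> * y)" .
  moreover have "theta_prod ((t/2 + 1/2) / t) t' = theta_prod (t'/2 + 1/2) t'"
    using theta_prod_half_minus[of "t'/2" t'] t0 by (simp add: t'_def add_divide_distrib mult.commute)
  ultimately have "- \<i> * y ^ 2 * c' ^ 2 = K * (x * (\<i> * y)) * (- \<i> * (1 / x ^ 2) * c ^ 2)"
    using K[of "t/2 + 1/2"] unfolding L(3) L'(3) by (simp only:)
  then have "- \<i> * (x * (y ^ 2 * c' ^ 2)) = - \<i> * (\<i> * K * y * c ^ 2)"
    using xy by (simp add: field_simps power2_eq_square)
  then have "x * (y ^ 2 * c' ^ 2) = \<i> * K * y * c ^ 2"
    by (rule mult_left_cancel[THEN iffD1, rotated]) simp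
  then have "y * (x * (y * c' ^ 2)) = y * (\<i> * K * c ^ 2)"
    by (simp add: power2_eq_square mult_ac)
  then have 3: "x * (y * c' ^ 2) = \<i> * K * c ^ 2" using xy by simp
  \<comment> \<open>Relation 4 compares the derivatives of both sides of the inversion formula at
    0.\<close>
  have "((\<lambda>z. theta_prod z t') has_field_derivative - 2 * pi * \<i> * e' ^ 2) (at (0 / t))"
    using has_field_derivative_theta_prod_0[OF t'] by (simp add: e'_def euler_prod_def)
  moreover have "((\<lambda>z. z / t) has_field_derivative 1 / t) (at 0)"
    using t0 by (auto intro!: derivative_eq_intros)
  ultimately have "((\<lambda>z. theta_prod (z / t) t') has_field_derivative - 2 * pi * \<i> * e' ^ 2 * (1 / t)) (at 0)"
    by (rule DERIV_chain2)
  moreover have "((\<lambda>z. K * exp (pi * \<i> * z ^ 2 / t) * theta_prod z t) has_field_derivative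
      K * (- 2 * pi * \<i> * e ^ 2)) (at 0)"
    unfolding e_def euler_prod_def
    by (rule derivative_eq_intros has_field_derivative_theta_prod_0[OF t] refl | simp add: t0)+
  ultimately have "- 2 * pi * \<i> * e' ^ 2 * (1 / t) = K * (- 2 * pi * \<i> * e ^ 2)"
    by (intro DERIV_unique[of "\<lambda>z. theta_prod (z / t) t'"]) (simp_all add: K)
  then have 4: "e' ^ 2 = t * K * e ^ 2"
    using t0 by (simp add: field_simps)
  \<comment> \<open>In the product of relations 1, 2, 3 the infinite products cancel by
    \<open>abc\<close>, which leaves \<open>K ^ 3\<close>.\<close>
  have "(- 2 * \<i> * a' ^ 2 * x) * (y * b' ^ 2) * (x * (y * c' ^ 2)) =
      (K * b ^ 2) * (2 * \<i> * K * a ^ 2) * (\<i> * K * c ^ 2)"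
    by (simp only: 1 2 3)
  also have "(- 2 * \<i> * a' ^ 2 * x) * (y * b' ^ 2) * (x * (y * c' ^ 2)) = - 2 * \<i> * x^2 * y^2 * (b' * c' * a') ^ 2"
    by (simp add: algebra_simps power2_eq_square)
  also have "(K * b ^ 2) * (2 * \<i> * K * a ^ 2) * (\<i> * K * c ^ 2) = - 2 * K ^ 3 * (b * c * a) ^ 2"
    by (simp add: algebra_simps power2_eq_square power3_eq_cube)
  finally have K3: "K ^ 3 = \<i> * x^2 * y^2"
    by (simp add: abc) (simp add: mult.assoc)
  \<comment> \<open>Relation 2 squared supplies \<open>K ^ 2\<close>, relation 4 the third factor
    \<open>K\<close>.\<close>
  have "y^2 * b' ^ 4 = (y * b' ^ 2) ^ 2"
    by (simp add: power_mult_distrib power_mult[symmetric])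
  also have "\<dots> = - 4 * K^2 * a ^ 4"
    unfolding 2 by (simp add: power_mult_distrib power_mult[symmetric])
  finally have "y^2 * (e' ^ 2 * b' ^ 4) = - 4 * t * K ^ 3 * e ^ 2 * a ^ 4"
    unfolding 4 by (simp add: power2_eq_square power3_eq_cube mult_ac)
  then have "y^2 * (e' ^ 2 * b' ^ 4) = y^2 * (- \<i> * t * (4 * x^2 * e ^ 2 * a ^ 4))"
    unfolding K3 by (simp add: mult_ac)
  then have "e' ^ 2 * b' ^ 4 = - \<i> * t * (4 * x^2 * e ^ 2 * a ^ 4)"
    by (rule mult_left_cancel[THEN iffD1, rotated]) (use xy in simp)
  then show ?thesis
    unfolding theta4_sq_def theta2_sq_def x2 t'_def[symmetric] e_def[symmetric] e'_def[symmetric]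
      a_def[symmetric] b'_def[symmetric] .
qed

lemma theta2_sq_inversion:
  assumes t: "Im t > 0"
  shows "theta2_sq (- 1 / t) = - \<i> * t * theta4_sq t"
proof -
  have "t \<noteq> 0" "Im (- 1 / t) > 0" using t Im_inversion_pos[OF t] by auto
  from theta4_sq_inversion[OF this(2)] this(1) show ?thesis
    by (simp add: field_simps)
qed

text \<open>A translation by 1 leads to \<open>theta4_sq\<close>; then -1/t - 1 = -1/(t/(1 + t)) and
  t/(1 + t) = 1 - 1/(1 + t) reduce the claim to the other two inversion formulas.\<close>

lemma theta3_sq_inversion:
  assumes t: "Im t > 0"
  shows "theta3_sq (- 1 / t) = - \<i> * t * theta3_sq t"
proof -
  have t1: "Im (1 + t) > 0" "1 + t \<noteq> 0" "t \<noteq> 0" using t by (auto simp: complex_eq_iff)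
  have s: "Im (t / (1 + t)) > 0" 
  proof -
    have "t / (1 + t) = 1 + (- 1 / (1 + t))" using t1 by (simp add: field_simps)
    then show ?thesis using Im_inversion_pos[OF t1(1)] by (simp only: plus_complex.sel) simp
  qed
  have "theta3_sq (- 1 / t) = theta3_sq ((- 1 / t - 1) + 1)" by simp
  also have "\<dots> = theta4_sq (- 1 / t - 1)" by (rule theta3_sq_add_1)
  also have "- 1 / t - 1 = - 1 / (t / (1 + t))" using t1 by (simp add: field_simps)
  also have "theta4_sq \<dots> = - \<i> * (t / (1 + t)) * theta2_sq (t / (1 + t))"
    by (rule theta4_sq_inversion[OF s])
  also have "theta2_sq (t / (1 + t)) = (1 + t) * theta3_sq t"
  proof -
    have "t / (1 + t) = - 1 / (1 + t) + 1" using t1 by (simp add: field_simps)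
    then have "theta2_sq (t / (1 + t)) = \<i> * theta2_sq (- 1 / (1 + t))"
      by (simp only: theta2_sq_add_1)
    also have "theta2_sq (- 1 / (1 + t)) = - \<i> * (1 + t) * theta3_sq t"
      using theta2_sq_inversion[OF t1(1)] theta4_sq_add_1[of t] by (simp add: add.commute)
    finally show ?thesis by (simp add: algebra_simps)
  qed
  finally show ?thesis using t1 by simp
qed

section \<open>Action of the modular group\<close>

lemma moebius_denominator_nonzero:
  fixes a b c d :: int
  assumes "a * d - b * c > 0" "Im t > 0"
  shows "of_int c * t + of_int d \<noteq> 0"
proof
  assume "of_int c * t + of_int d = 0"
  then have "of_int c * Im t = 0" "of_int c * Re t + of_int d = 0"
    by (simp_all add: complex_eq_iff)
  then have "c = 0" "d = 0" using assms(2) by auto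
  with assms(1) show False by simp
qed

lemma Im_moebius_pos:
  fixes a b c d :: int
  assumes "a * d - b * c > 0" "Im t > 0"
  shows "Im ((of_int a * t + of_int b) / (of_int c * t + of_int d)) > 0"
proof -
  have "Im ((of_int a * t + of_int b) / (of_int c * t + of_int d)) =
      of_int (a * d - b * c) * Im t / (cmod (of_int c * t + of_int d))\<^sup>2"
    by (simp add: Im_divide cmod_power2 algebra_simps diff_divide_distrib)
  moreover have "real_of_int (a * d - b * c) > 0"
    using assms(1) by (simp only: of_int_0_less_iff)
  ultimately show ?thesis
    using assms moebius_denominator_nonzero[OF assms] by (simp only:) (intro divide_pos_pos mult_pos_pos, auto)
qed

lemma i_powi_cong:
  fixes m n :: int
  assumes "4 dvd m - n"
  shows "\<i> powi m = \<i> powi n"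
proof -
  obtain k where "m = n + 4 * k" using assms by (auto elim!: dvdE simp: algebra_simps)
  then show ?thesis by (simp add: power_int_add power_int_mult)
qed

lemma theta4_sq_add_even:
  assumes "even (n :: int)"
  shows "theta4_sq (t + of_int n) = theta4_sq t"
proof -
  obtain k where k: "n = 2 * k" using assms by (elim evenE)
  have step: "theta4_sq (u + 2) = theta4_sq u" for u
    using theta4_sq_add_1[of "u + 1"] theta3_sq_add_1[of u] by (simp add: add_ac)
  have nat: "theta4_sq (u + 2 * of_nat m) = theta4_sq u" for u m
    by (induction m) (use step[of "u + 2 * of_nat m" for m] in \<open>auto simp: algebra_simps\<close>)
  show ?thesis
    using nat[of t "nat k"] nat[of "t + 2 * of_int k" "nat (- k)"] k by (cases "k \<ge> 0") auto
qed

text \<open>The map t / (t + 1) is inversion, translation by -1, inversion. The first inversion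
  passes to \<open>theta2_sq\<close>, which a translation multiplies by a constant. The case
  \<open>s = - 1\<close> is the case \<open>s = 1\<close> read at t / (1 - t).\<close>

lemma theta4_sq_shear:
  assumes t: "Im t > 0" and s: "s = 1 \<or> s = (- 1 :: int)"
  shows "theta4_sq (t / (of_int s * t + 1)) = \<i> powi (- s) * (of_int s * t + 1) * theta4_sq t"
proof -
  have pos: "theta4_sq (t / (t + 1)) = - \<i> * (t + 1) * theta4_sq t" if t: "Im t > 0" for t
  proof -
    have t1: "t \<noteq> 0" "t + 1 \<noteq> 0" using t by (auto simp: complex_eq_iff)
    define u where "u = - 1 / t"
    have u: "Im u > 0" using Im_inversion_pos[OF t] by (simp add: u_def)
    then have u1: "Im (u - 1) > 0" by simp
    have "u - 1 = - ((t + 1) / t)"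
      using t1 by (simp add: u_def field_simps)
    then have "theta4_sq (t / (t + 1)) = theta4_sq (- 1 / (u - 1))"
      by simp
    also have "\<dots> = - \<i> * (u - 1) * theta2_sq (u - 1)"
      by (rule theta4_sq_inversion[OF u1])
    also have "theta2_sq (u - 1) = - \<i> * theta2_sq u"
      using theta2_sq_add_1[of "u - 1"] by simp
    also have "theta2_sq u = - \<i> * t * theta4_sq t"
      unfolding u_def by (rule theta2_sq_inversion[OF t])
    finally have "theta4_sq (t / (t + 1)) = \<i> * ((u - 1) * t) * theta4_sq t"
      by (simp add: algebra_simps)
    also have "(u - 1) * t = - (t + 1)"
      using t1 by (simp add: u_def field_simps)
    finally show ?thesis by (simp add: algebra_simps)
  qed
  show ?thesis
  proof (cases "s = 1")
    case True
    then show ?thesis using pos[OF t] by simp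
  next
    case False
    then have s: "s = - 1" using s by simp
    have t1: "1 - t \<noteq> 0" using t by (auto simp: complex_eq_iff)
    define u where "u = t / (1 - t)"
    have "Im u > 0"
      using Im_moebius_pos[of 1 1 0 "- 1" t] t by (simp add: u_def)
    from pos[OF this] have "theta4_sq t = - \<i> * (1 / (1 - t)) * theta4_sq u"
      using t1 by (simp add: u_def field_simps)
    then have "\<i> * (1 - t) * theta4_sq t = theta4_sq u"
      using t1 by (simp add: mult.assoc[symmetric])
    then show ?thesis by (simp add: s u_def)
  qed
qed

text \<open>Descent along \<open>t \<mapsto> t + 2\<close> and \<open>t \<mapsto> t / (t + 1)\<close>, which generate the relevant group up to sign.
  For odd \<open>d\<close> the factor \<open>\<i> powi (d - 1)\<close> is the nontrivial character modulo 4.\<close>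
lemma theta4_sq_transform:
  fixes a b c d :: int
  assumes "a * d - b * c = 1" "even b" "Im t > 0"
  shows "theta4_sq ((of_int a * t + of_int b) / (of_int c * t + of_int d)) =
    \<i> powi (d - 1 - c * d) * (of_int c * t + of_int d) * theta4_sq t"
  using assms
proof (induction "nat (\<bar>c\<bar> + \<bar>d\<bar>)" arbitrary: a b c d t rule: less_induct)
  case less
  note det = less.prems(1) and b = less.prems(2) and t = less.prems(3)
  have "odd (a * d)" using det b by (metis add_diff_cancel_left' diff_add_cancel even_mult_iff even_add odd_one)
  then have d: "odd d" by simp
  then have d0: "d \<noteq> 0" by auto
  \<comment> \<open>With this sign, subtracting \<open>s * d\<close> moves \<open>c\<close> towards
    0, and subtracting \<open>s * c\<close> moves \<open>d\<close> towards 0.\<close>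
  define s where "s = sgn c * sgn d"
  have den: "of_int c * t + of_int d \<noteq> 0"
    using moebius_denominator_nonzero[of a d b c t] det t by simp
  \<comment> \<open>The cases are a translation up to sign, a shear that decreases |c|, and a shift
    by 2 that decreases |d|.\<close>
  consider "c = 0" | "c \<noteq> 0" "\<bar>c\<bar> \<ge> \<bar>d\<bar>" | "c \<noteq> 0" "\<bar>c\<bar> < \<bar>d\<bar>" by linarith
  then show ?case
  proof cases
    case 1
    then have "a * d = 1" using det by simp
    then have ad: "a = 1 \<and> d = 1 \<or> a = - 1 \<and> d = - 1" using zmult_eq_1_iff by blast
    then have "(of_int a * t + of_int b) / (of_int c * t + of_int d) = t + of_int (b * d)"
      using 1 by auto
    moreover have "theta4_sq (t + of_int (b * d)) = theta4_sq t"
      using b by (intro theta4_sq_add_even) auto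
    moreover have "\<i> powi (d - 1 - c * d) * (of_int c * t + of_int d) = 1"
      using ad 1 by (auto simp: power_int_minus)
    ultimately show ?thesis by simp
  next
    case 2
    then have s: "s = 1 \<or> s = - 1" and sd: "s * d = sgn c * \<bar>d\<bar>"
      using d0 by (auto simp: s_def sgn_if abs_if)
    have less': "\<bar>c - s * d\<bar> < \<bar>c\<bar>"
      using 2 d0 by (auto simp: sd sgn_if abs_if)
    define u where "u = t / (of_int s * t + 1)"
    have s1: "of_int s * t + 1 \<noteq> 0"
      using moebius_denominator_nonzero[of 1 1 0 s t] t by simp
    have u: "Im u > 0"
      using Im_moebius_pos[of 1 1 0 s t] t by (simp add: u_def)
    have "theta4_sq ((of_int (a - s * b) * u + of_int b) / (of_int (c - s * d) * u + of_int d)) =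
        \<i> powi (d - 1 - (c - s * d) * d) * (of_int (c - s * d) * u + of_int d) * theta4_sq u"
    proof (rule less.hyps)
      show "nat (\<bar>c - s * d\<bar> + \<bar>d\<bar>) < nat (\<bar>c\<bar> + \<bar>d\<bar>)" using less' by linarith
      show "(a - s * b) * d - b * (c - s * d) = 1" using det by (simp add: algebra_simps)
    qed (use b u in auto)
    moreover have "(of_int (c - s * d) * u + of_int d) = (of_int c * t + of_int d) / (of_int s * t + 1)"
      "(of_int (a - s * b) * u + of_int b) = (of_int a * t + of_int b) / (of_int s * t + 1)"
      using s1 by (simp_all add: u_def field_simps)
    moreover have "theta4_sq u = \<i> powi (- s) * (of_int s * t + 1) * theta4_sq t"
      unfolding u_def by (rule theta4_sq_shear[OF t s])
    \<comment> \<open>The exponents differ by \<open>s * ((d - 1) * (d + 1))\<close>, a multiple of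
      4 because \<open>d\<close> is odd.\<close>
    moreover have "\<i> powi (d - 1 - (c - s * d) * d) * \<i> powi (- s) = \<i> powi (d - 1 - c * d)"
    proof -
      have "even (d - 1)" "even (d + 1)" using d by auto
      then have "2 * 2 dvd (d - 1) * (d + 1)" by (rule mult_dvd_mono)
      then have "4 dvd s * ((d - 1) * (d + 1))" by (simp add: dvd_mult)
      also have "s * ((d - 1) * (d + 1)) = (d - 1 - (c - s * d) * d + - s) - (d - 1 - c * d)"
        by (simp add: algebra_simps)
      finally show ?thesis
        by (subst power_int_add[symmetric]) (auto intro: i_powi_cong)
    qed
    ultimately show ?thesis using s1 by (simp add: mult_ac) 
  next
    case 3
    then have s: "s = 1 \<or> s = - 1" and sc: "s * c = sgn d * \<bar>c\<bar>"
      using d0 by (auto simp: s_def sgn_if abs_if)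
    have less': "\<bar>d - 2 * (s * c)\<bar> < \<bar>d\<bar>"
      using 3 d0 by (auto simp: sc sgn_if abs_if)
    have "theta4_sq ((of_int a * (t + of_int (2 * s)) + of_int (b - 2 * s * a)) /
          (of_int c * (t + of_int (2 * s)) + of_int (d - 2 * s * c))) =
        \<i> powi ((d - 2 * s * c) - 1 - c * (d - 2 * s * c)) *
          (of_int c * (t + of_int (2 * s)) + of_int (d - 2 * s * c)) * theta4_sq (t + of_int (2 * s))"
    proof (rule less.hyps)
      show "nat (\<bar>c\<bar> + \<bar>d - 2 * s * c\<bar>) < nat (\<bar>c\<bar> + \<bar>d\<bar>)" using less' by (simp add: mult.assoc)
      show "a * (d - 2 * s * c) - (b - 2 * s * a) * c = 1" using det by (simp add: algebra_simps)
    qed (use b t in auto)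
    moreover have "of_int a * (t + of_int (2 * s)) + of_int (b - 2 * s * a) = of_int a * t + of_int b"
      "of_int c * (t + of_int (2 * s)) + of_int (d - 2 * s * c) = of_int c * t + of_int d"
      by (simp_all add: algebra_simps)
    moreover have "theta4_sq (t + of_int (2 * s)) = theta4_sq t"
      by (rule theta4_sq_add_even) simp
    moreover have "\<i> powi ((d - 2 * s * c) - 1 - c * (d - 2 * s * c)) = \<i> powi (d - 1 - c * d)"
    proof (rule i_powi_cong)
      have "even (c * (c - 1))" by simp
      then have "2 * 2 dvd 2 * (c * (c - 1))" by (intro mult_dvd_mono) auto
      then have "4 dvd s * (2 * (c * (c - 1)))" by (simp add: dvd_mult)
      also have "s * (2 * (c * (c - 1))) =
          ((d - 2 * s * c) - 1 - c * (d - 2 * s * c)) - (d - 1 - c * d)"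
        by (simp add: algebra_simps)
      finally show "4 dvd ((d - 2 * s * c) - 1 - c * (d - 2 * s * c)) - (d - 1 - c * d)" .
    qed
    ultimately show ?thesis by (simp only:)
  qed
qed

lemma g_Gamma0_invariant:
  assumes "in_Gamma0 10 a b c d" "Im \<tau> > 0"
  shows "g (moebius_act a b c d \<tau>) = g \<tau>"
proof -
  obtain e where det: "a * d - b * c = 1" and c: "c = 10 * e"
    using assms(1) by (auto simp: in_Gamma0_def)
  define w where "w = moebius_act a b c d \<tau>"
  define j where "j = of_int c * \<tau> + of_int d"
  have j: "j \<noteq> 0"
    using moebius_denominator_nonzero[of a d b c \<tau>] det assms(2) by (simp add: j_def)
  have w: "Im w > 0"
    using Im_moebius_pos[of a d b c \<tau>] det assms(2) by (simp add: w_def moebius_act_def)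
  \<comment> \<open>The matrix acts on \<open>10 * \<tau>\<close> as (a, 10 b; e, d) and on
    \<open>2 * \<tau>\<close> as (a, 2 b; 5 e, d). Both have determinant 1 and an even upper right
    entry, and the two exponents of \<i> differ by \<open>4 * e * d\<close>.\<close>
  have "theta4_sq (10 * w) = \<i> powi (d - 1 - e * d) * j * theta4_sq (10 * \<tau>)"
    using theta4_sq_transform[of a d "10 * b" e "10 * \<tau>"] det c assms(2)
    by (simp add: w_def moebius_act_def j_def mult_ac distrib_left)
  moreover have "theta4_sq (2 * w) = \<i> powi (d - 1 - 5 * e * d) * j * theta4_sq (2 * \<tau>)"
    using theta4_sq_transform[of a d "2 * b" "5 * e" "2 * \<tau>"] det c assms(2)
    by (simp add: w_def moebius_act_def j_def mult_ac distrib_left)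
  moreover have "\<i> powi (d - 1 - 5 * e * d) = \<i> powi (d - 1 - e * d)"
    by (rule i_powi_cong) (simp add: algebra_simps)
  ultimately show ?thesis
    using j by (simp add: g_eq_theta4_sq assms(2) w w_def[symmetric])
qed

section \<open>Expansions at the cusps\<close>

text \<open>At a cusp it suffices that the modular group sends each member to some member, up to a
  constant and a factor of weight one; the set hides which one.\<close>

definition theta_squares :: "(complex \<Rightarrow> complex) set" where
  "theta_squares = {theta2_sq, theta3_sq, theta4_sq}"

lemma theta_squares_translate:
  fixes n :: int
  assumes "X \<in> theta_squares"
  shows "\<exists>Y\<in>theta_squares. \<exists>\<epsilon>\<noteq>0. \<forall>t. X (t + of_int n) = \<epsilon> * Y t"
  using assms
proof (induction n arbitrary: X rule: int_induct[where k = 0])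
  case base
  then show ?case by (intro bexI[of _ X] exI[of _ 1]) auto
next
  case (step1 n)
  obtain Y \<epsilon> where Y: "Y \<in> theta_squares" "\<epsilon> \<noteq> 0" "\<And>t. X (t + 1) = \<epsilon> * Y t"
  proof -
    have "\<exists>Y\<in>theta_squares. \<exists>\<epsilon>\<noteq>0. \<forall>t. X (t + 1) = \<epsilon> * Y t"
      using step1.prems theta2_sq_add_1 theta3_sq_add_1 theta4_sq_add_1
      unfolding theta_squares_def by (auto intro: exI[of _ \<i>] exI[of _ 1])
    then show ?thesis using that by blast
  qed
  obtain Z \<delta> where Z: "Z \<in> theta_squares" "\<delta> \<noteq> 0" "\<And>t. Y (t + of_int n) = \<delta> * Z t"
    using step1.IH[OF Y(1)] by blast
  have "X (t + of_int (n + 1)) = (\<epsilon> * \<delta>) * Z t" for t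
    using Y(3)[of "t + of_int n"] Z(3)[of t] by (simp add: add_ac)
  then show ?case using Y Z by (intro bexI[of _ Z] exI[of _ "\<epsilon> * \<delta>"]) auto
next
  case (step2 n)
  obtain Y \<epsilon> where Y: "Y \<in> theta_squares" "\<epsilon> \<noteq> 0" "\<And>t. X (t - 1) = \<epsilon> * Y t"
  proof -
    have "theta2_sq (t - 1) = - \<i> * theta2_sq t" "theta3_sq (t - 1) = theta4_sq t" "theta4_sq (t - 1) = theta3_sq t" for t
      using theta2_sq_add_1[of "t - 1"] theta3_sq_add_1[of "t - 1"] theta4_sq_add_1[of "t - 1"] by simp_all
    then have "\<exists>Y\<in>theta_squares. \<exists>\<epsilon>\<noteq>0. \<forall>t. X (t - 1) = \<epsilon> * Y t"
      using step2.prems unfolding theta_squares_def by (auto intro: exI[of _ "- \<i>"] exI[of _ 1])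
    then show ?thesis using that by blast
  qed
  obtain Z \<delta> where Z: "Z \<in> theta_squares" "\<delta> \<noteq> 0" "\<And>t. Y (t + of_int n) = \<delta> * Z t"
    using step2.IH[OF Y(1)] by blast
  have "X (t + of_int (n - 1)) = (\<epsilon> * \<delta>) * Z t" for t
    using Y(3)[of "t + of_int n"] Z(3)[of t] by (simp add: algebra_simps)
  then show ?case using Y Z by (intro bexI[of _ Z] exI[of _ "\<epsilon> * \<delta>"]) auto
qed

lemma theta_squares_inversion:
  assumes "X \<in> theta_squares"
  shows "\<exists>Y\<in>theta_squares. \<forall>t. Im t > 0 \<longrightarrow> X (- 1 / t) = - \<i> * t * Y t"
  using assms theta2_sq_inversion theta3_sq_inversion theta4_sq_inversion
  unfolding theta_squares_def by blast

text \<open>Euclidean descent on the lower row: with d = k c + r, the matrix is one with lower row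
  (-r, c), multiplied on the right by the inversion and then by the translation by
  \<open>k\<close>.\<close>

lemma theta_squares_SL2:
  fixes a b c d :: int
  assumes "X \<in> theta_squares" "a * d - b * c = 1"
  shows "\<exists>Y\<in>theta_squares. \<exists>\<epsilon>\<noteq>0. \<forall>t. Im t > 0 \<longrightarrow>
    X ((of_int a * t + of_int b) / (of_int c * t + of_int d)) = \<epsilon> * (of_int c * t + of_int d) * Y t"
  using assms
proof (induction "nat \<bar>c\<bar>" arbitrary: a b c d rule: less_induct)
  case less
  note det = less.prems(2)
  show ?case
  proof (cases "c = 0")
    case True
    then have "a * d = 1" using det by simp
    then have ad: "a = 1 \<and> d = 1 \<or> a = - 1 \<and> d = - 1" using zmult_eq_1_iff by blast
    obtain Y \<epsilon> where Y: "Y \<in> theta_squares" "\<epsilon> \<noteq> 0" "\<And>t. X (t + of_int (b * d)) = \<epsilon> * Y t"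
      using theta_squares_translate[OF less.prems(1)] by blast
    have "X ((of_int a * t + of_int b) / (of_int c * t + of_int d)) =
        (\<epsilon> / of_int d) * (of_int c * t + of_int d) * Y t" for t
    proof -
      have "(of_int a * t + of_int b) / (of_int c * t + of_int d) = t + of_int (b * d)"
        using ad True by auto
      then show ?thesis using Y(3)[of t] ad True by auto
    qed
    then show ?thesis using Y ad by (intro bexI[of _ Y] exI[of _ "\<epsilon> / of_int d"]) auto
  next
    case False
    define k where "k = d div c"
    define r where "r = d mod c"
    have d: "d = k * c + r" by (simp add: k_def r_def)
    have "nat \<bar>- r\<bar> < nat \<bar>c\<bar>"
      using False abs_mod_less[of c d] by (simp add: r_def)
    moreover have "(- (b - k * a)) * c - a * (- r) = 1"
      using det by (simp add: d algebra_simps)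
    ultimately obtain Y \<epsilon> where Y: "Y \<in> theta_squares" "\<epsilon> \<noteq> 0"
      "\<And>t. Im t > 0 \<Longrightarrow> X ((of_int (- (b - k * a)) * t + of_int a) / (of_int (- r) * t + of_int c)) =
         \<epsilon> * (of_int (- r) * t + of_int c) * Y t"
      using less.hyps[of "- r" "- (b - k * a)" c a] less.prems(1) by blast
    obtain Z where Z: "Z \<in> theta_squares" "\<And>t. Im t > 0 \<Longrightarrow> Y (- 1 / t) = - \<i> * t * Z t"
      using theta_squares_inversion[OF Y(1)] by blast
    obtain W \<delta> where W: "W \<in> theta_squares" "\<delta> \<noteq> 0" "\<And>t. Z (t + of_int k) = \<delta> * W t"
      using theta_squares_translate[OF Z(1)] by blast
    have "X ((of_int a * t + of_int b) / (of_int c * t + of_int d)) =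
       (- \<i> * \<epsilon> * \<delta>) * (of_int c * t + of_int d) * W t" if t: "Im t > 0" for t
    proof -
      define s where "s = t + of_int k"
      have s: "Im s > 0" using t by (simp add: s_def)
      then have "s \<noteq> 0" by auto
      note s = s this
      have num: "of_int (- (b - k * a)) * (- 1 / s) + of_int a = (of_int a * t + of_int b) / s"
        using s by (simp add: s_def field_simps)
      have den: "of_int (- r) * (- 1 / s) + of_int c = (of_int c * t + of_int d) / s"
        using s by (simp add: s_def d field_simps)
      have "X (((of_int a * t + of_int b) / s) / ((of_int c * t + of_int d) / s)) =
          \<epsilon> * ((of_int c * t + of_int d) / s) * Y (- 1 / s)"
        using Y(3)[OF Im_inversion_pos[OF s(1)]] unfolding num den .
      also have "Y (- 1 / s) = - \<i> * s * (\<delta> * W t)"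
        using Z(2)[OF s(1)] W(3)[of t] by (simp add: s_def)
      finally show ?thesis using s by (simp add: mult_ac)
    qed
    then show ?thesis using W Y by (intro bexI[of _ W] exI[of _ "- \<i> * \<epsilon> * \<delta>"]) auto
  qed
qed

text \<open>The matrix (N a, N b; c, d) of determinant \<open>N\<close> is a matrix of determinant 1
  times the triangular matrix (G, B; 0, D) with G D = N; the first factor is handled by
  \<open>theta_squares_SL2\<close>.\<close>

lemma theta_squares_scaled:
  fixes a b c d N :: int
  assumes X: "X \<in> theta_squares" and det: "a * d - b * c = 1" and N: "N > 0"
  obtains Y \<epsilon> G B D where "Y \<in> theta_squares" "\<epsilon> \<noteq> 0" "G > 0" "D > 0" "D dvd N"
    "\<And>t. Im t > 0 \<Longrightarrow> X (of_int N * ((of_int a * t + of_int b) / (of_int c * t + of_int d))) =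
       \<epsilon> * (of_int c * t + of_int d) * Y ((of_int G * t + of_int B) / of_int D)"
proof -
  \<comment> \<open>\<open>G\<close> is the gcd of the first column; the reduced column is completed
    to determinant 1 by Bezout.\<close>
  define G where "G = gcd (N * a) c"
  have "N * a \<noteq> 0 \<or> c \<noteq> 0" using det N by auto
  then have G: "G > 0" by (simp add: G_def)
  define \<alpha> where "\<alpha> = N * a div G"
  define \<gamma> where "\<gamma> = c div G"
  have \<alpha>: "N * a = \<alpha> * G" and \<gamma>: "c = \<gamma> * G" by (simp_all add: \<alpha>_def \<gamma>_def G_def)
  have "coprime \<alpha> \<gamma>"
    unfolding \<alpha>_def \<gamma>_def G_def by (rule div_gcd_coprime) (use \<open>N * a \<noteq> 0 \<or> c \<noteq> 0\<close> in auto)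
  then obtain \<delta> \<beta> where \<delta>: "\<delta> * \<alpha> + \<beta> * \<gamma> = 1"
    using bezout_int[of \<alpha> \<gamma>] by auto
  define \<beta>' where "\<beta>' = - \<beta>"
  have det': "\<alpha> * \<delta> - \<beta>' * \<gamma> = 1" using \<delta> by (simp add: \<beta>'_def algebra_simps)
  define B where "B = \<delta> * (N * b) - \<beta>' * d"
  define D where "D = \<alpha> * d - \<gamma> * (N * b)"
  have GD: "G * D = N"
  proof -
    have "G * D = (\<alpha> * G) * d - (\<gamma> * G) * (N * b)" by (simp add: D_def algebra_simps)
    also have "\<dots> = N * (a * d - b * c)" by (simp only: \<alpha>[symmetric] \<gamma>[symmetric]) (simp add: algebra_simps)
    finally show ?thesis using det by simp
  qed
  then have D: "D > 0" "D dvd N" using G N by (auto simp: zero_less_mult_iff dvd_def mult.commute)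
  have row2: "\<gamma> * B + \<delta> * D = d"
  proof -
    have "\<gamma> * B + \<delta> * D = (\<alpha> * \<delta> - \<beta>' * \<gamma>) * d" by (simp add: B_def D_def algebra_simps)
    then show ?thesis using det' by simp
  qed
  have row1: "\<alpha> * B + \<beta>' * D = N * b"
  proof -
    have "\<alpha> * B + \<beta>' * D = (\<alpha> * \<delta> - \<beta>' * \<gamma>) * (N * b)" by (simp add: B_def D_def algebra_simps)
    then show ?thesis using det' by simp
  qed
  obtain Y \<epsilon> where Y: "Y \<in> theta_squares" "\<epsilon> \<noteq> 0"
    "\<And>t. Im t > 0 \<Longrightarrow> X ((of_int \<alpha> * t + of_int \<beta>') / (of_int \<gamma> * t + of_int \<delta>)) =
      \<epsilon> * (of_int \<gamma> * t + of_int \<delta>) * Y t"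
    using theta_squares_SL2[OF X det'] by blast
  have "X (of_int N * ((of_int a * t + of_int b) / (of_int c * t + of_int d))) =
     (\<epsilon> / of_int D) * (of_int c * t + of_int d) * Y ((of_int G * t + of_int B) / of_int D)"
    if t: "Im t > 0" for t
  proof -
    define u where "u = (of_int G * t + of_int B) / of_int D"
    have u: "Im u > 0"
      using Im_moebius_pos[of G D B 0 t] G D t by (simp add: u_def)
    have D0: "(of_int D :: complex) \<noteq> 0" using D by simp
    have "of_int \<alpha> * u + of_int \<beta>' = (of_int (\<alpha> * G) * t + of_int (\<alpha> * B + \<beta>' * D)) / of_int D"
      using D0 by (simp add: u_def field_simps)
    then have num: "of_int \<alpha> * u + of_int \<beta>' = of_int N * (of_int a * t + of_int b) / of_int D"
      unfolding row1 \<alpha>[symmetric] by (simp add: algebra_simps)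
    have "of_int \<gamma> * u + of_int \<delta> = (of_int (\<gamma> * G) * t + of_int (\<gamma> * B + \<delta> * D)) / of_int D"
      using D0 by (simp add: u_def field_simps)
    then have den: "of_int \<gamma> * u + of_int \<delta> = (of_int c * t + of_int d) / of_int D"
      unfolding row2 \<gamma>[symmetric] .
    show ?thesis
      using Y(3)[OF u] D0 unfolding num den by (simp add: u_def)
  qed
  then show thesis
    using that[of Y "\<epsilon> / of_int D" G D B] Y G D by auto
qed

text \<open>All three squares are holomorphic in \<open>qn (u / 4)\<close>, the fourth root being
  dictated by the prefactor of \<open>theta2_sq\<close>. At u = (G t + B) / D this is a root of
  unity times an integral power of \<open>qn (t / 40)\<close>, so one local parameter serves all
  \<open>D\<close> dividing 10.\<close>

lemma theta_squares_meromorphic: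
  assumes "Y \<in> theta_squares" "G > 0" "D > 0" "D dvd (10 :: int)"
  shows "\<exists>M. M meromorphic_on {0} \<and>
    (\<forall>t. Im t > 0 \<longrightarrow> Y ((of_int G * t + of_int B) / of_int D) = M (qn (t / 40)))"
proof -
  define k where "k = nat (G * (10 div D))"
  have k: "k > 0"
    using assms by (auto simp: k_def pos_imp_zdiv_pos_iff zdvd_imp_le)
  define \<zeta> where "\<zeta> = qn (of_int B / (4 * of_int D))"
  have \<zeta>: "norm \<zeta> = 1"
    by (simp add: \<zeta>_def qn_def)
  define p where "p = (\<lambda>w. \<zeta> * w ^ k)"
  have p: "norm (p w) < 1" if "w \<in> ball 0 1" for w
    using that k by (simp add: p_def norm_mult \<zeta> norm_power power_less_one_iff)
  have p4: "norm (p w ^ 4) < 1" if "w \<in> ball 0 1" for w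
    using p[OF that] by (simp add: norm_power power_less_one_iff)
  have holp: "p holomorphic_on ball 0 1"
    unfolding p_def by (intro holomorphic_intros)
  have quarter: "qn ((of_int G * t + of_int B) / of_int D / 4) = p (qn (t / 40))" for t
  proof -
    have "of_nat k = (of_int G * 10 / of_int D :: complex)"
    proof -
      obtain m where m: "10 = D * m" using assms(4) by (elim dvdE)
      then have "m > 0" using assms(3) by (metis zero_less_mult_pos zero_less_numeral)
      moreover have "10 div D = m" unfolding m using assms(3) by simp
      ultimately have "of_nat k = (of_int (G * m) :: complex)"
        using assms(2) by (simp add: k_def)
      moreover have "(10 :: complex) = of_int D * of_int m"
        using m by (metis of_int_mult of_int_numeral)
      then have "(10 :: complex) / of_int D = of_int m"
        using assms(3) by (simp add: divide_eq_eq mult.commute)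
      ultimately show ?thesis by (simp flip: times_divide_eq_right)
    qed
    then have "(of_int G * t + of_int B) / of_int D / 4 = of_int B / (4 * of_int D) + of_nat k * (t / 40)"
      using assms by (simp add: field_simps)
    then show ?thesis
      by (simp only: qn_add qn_of_nat_mult p_def \<zeta>_def)
  qed
  have half: "qn (u / 2) = qn (u / 4) ^ 2" and full: "qn u = qn (u / 4) ^ 4" for u
    by (simp_all add: qn_numeral_mult[symmetric])
  have quart_exp: "exp (pi * \<i> * u / 2) = qn (u / 4)" for u
    by (simp add: qn_def mult_ac)
  let ?M2 = "\<lambda>w. 4 * p w * euler_prod (p w ^ 4) ^ 2 * qpoch_inf (- (p w ^ 4)) (p w ^ 4) ^ 4"
  let ?M3 = "\<lambda>w. euler_prod (p w ^ 4) ^ 2 * qpoch_inf (- (p w ^ 2)) (p w ^ 4) ^ 4"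
  let ?M4 = "\<lambda>w. euler_prod (p w ^ 4) ^ 2 * qpoch_inf (p w ^ 2) (p w ^ 4) ^ 4"
  have hol: "(\<lambda>w. qpoch_inf (f w) (p w ^ 4)) holomorphic_on ball 0 1" if "f holomorphic_on ball 0 1" for f
    using that p4 by (intro holomorphic_on_qpoch_inf holomorphic_intros holp) auto
  have "?M2 holomorphic_on ball 0 1" "?M3 holomorphic_on ball 0 1" "?M4 holomorphic_on ball 0 1"
    unfolding euler_prod_def by (intro holomorphic_intros hol holp)+
  then have mero: "?M2 meromorphic_on {0}" "?M3 meromorphic_on {0}" "?M4 meromorphic_on {0}"
    by (auto intro!: analytic_on_imp_meromorphic_on holomorphic_on_imp_analytic_at[of _ "ball 0 1"])
  have "theta2_sq u = 4 * qn (u/4) * euler_prod (qn (u/4) ^ 4) ^ 2 * qpoch_inf (- (qn (u/4) ^ 4)) (qn (u/4) ^ 4) ^ 4"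
    "theta3_sq u = euler_prod (qn (u/4) ^ 4) ^ 2 * qpoch_inf (- (qn (u/4) ^ 2)) (qn (u/4) ^ 4) ^ 4"
    "theta4_sq u = euler_prod (qn (u/4) ^ 4) ^ 2 * qpoch_inf (qn (u/4) ^ 2) (qn (u/4) ^ 4) ^ 4" for u
    by (simp_all only: theta2_sq_def theta3_sq_def theta4_sq_def quart_exp full[symmetric] half[symmetric])
  then have "theta2_sq ((of_int G * t + of_int B) / of_int D) = ?M2 (qn (t / 40))"
    "theta3_sq ((of_int G * t + of_int B) / of_int D) = ?M3 (qn (t / 40))"
    "theta4_sq ((of_int G * t + of_int B) / of_int D) = ?M4 (qn (t / 40))" for t
    by (simp_all only: quarter)
  with mero assms(1) show ?thesis
    unfolding theta_squares_def by blast
qed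

text \<open>In the quotient of the two values of \<open>theta4_sq\<close> the factors
  \<open>of_int c * t + of_int d\<close> cancel, leaving a quotient of meromorphic functions of the
  same parameter.\<close>

lemma g_cusp_expansion:
  fixes a b c d :: int
  assumes det: "a * d - b * c = 1"
  shows "\<exists>M. M meromorphic_on {0} \<and> (\<forall>t. Im t > 0 \<longrightarrow> g (moebius_act a b c d t) = M (qn (t / 40)))"
proof -
  have th: "theta4_sq \<in> theta_squares" by (simp add: theta_squares_def)
  obtain Y \<epsilon> G B D where 1: "Y \<in> theta_squares" "\<epsilon> \<noteq> 0" "G > 0" "D > 0" "D dvd 10"
    "\<And>t. Im t > 0 \<Longrightarrow> theta4_sq (of_int 10 * ((of_int a * t + of_int b) / (of_int c * t + of_int d))) =
       \<epsilon> * (of_int c * t + of_int d) * Y ((of_int G * t + of_int B) / of_int D)"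
    by (rule theta_squares_scaled[OF th det, of 10]) (simp, blast)
  obtain Y' \<epsilon>' G' B' D' where 2: "Y' \<in> theta_squares" "\<epsilon>' \<noteq> 0" "G' > 0" "D' > 0" "D' dvd 2"
    "\<And>t. Im t > 0 \<Longrightarrow> theta4_sq (of_int 2 * ((of_int a * t + of_int b) / (of_int c * t + of_int d))) =
       \<epsilon>' * (of_int c * t + of_int d) * Y' ((of_int G' * t + of_int B') / of_int D')"
    by (rule theta_squares_scaled[OF th det, of 2]) (simp, blast)
  have D': "D' dvd 10" using 2(5) by (rule dvd_trans) simp
  obtain M where M: "M meromorphic_on {0}"
    "\<And>t. Im t > 0 \<Longrightarrow> Y ((of_int G * t + of_int B) / of_int D) = M (qn (t / 40))"
    using theta_squares_meromorphic[OF 1(1,3,4,5)] by blast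
  obtain M' where M': "M' meromorphic_on {0}"
    "\<And>t. Im t > 0 \<Longrightarrow> Y' ((of_int G' * t + of_int B') / of_int D') = M' (qn (t / 40))"
    using theta_squares_meromorphic[OF 2(1,3,4) D'] by blast
  have "(\<lambda>w. (\<epsilon> * M w) / (\<epsilon>' * M' w)) meromorphic_on {0}"
    by (intro meromorphic_intros M M')
  moreover have "g (moebius_act a b c d t) = (\<epsilon> * M (qn (t / 40))) / (\<epsilon>' * M' (qn (t / 40)))" if t: "Im t > 0" for t
  proof -
    have "Im (moebius_act a b c d t) > 0" "of_int c * t + of_int d \<noteq> 0"
      using Im_moebius_pos[of a d b c t] moebius_denominator_nonzero[of a d b c t] det t
      by (simp_all add: moebius_act_def)
    then show ?thesis
      using 1(6)[OF t] 2(6)[OF t] M(2)[OF t] M'(2)[OF t]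
      by (simp add: g_eq_theta4_sq moebius_act_def)
  qed
  ultimately show ?thesis by blast
qed

section \<open>Holomorphy of \<open>g\<close> and conclusion\<close>

lemma g_holomorphic: "g holomorphic_on upper_half_plane"
proof -
  have op: "open upper_half_plane"
    unfolding upper_half_plane_def by (rule open_halfspace_Im_gt)
  have hol: "(\<lambda>\<tau>. euler_prod (qn \<tau> ^ n)) holomorphic_on upper_half_plane" if "n > 0" for n
    unfolding euler_prod_def
    by (intro holomorphic_on_qpoch_inf op holomorphic_intros)
       (use that in \<open>auto simp: upper_half_plane_def norm_power power_less_one_iff norm_qn_less_1_iff\<close>)
  have nz: "euler_prod (qn \<tau> ^ n) \<noteq> 0" if "n > 0" "\<tau> \<in> upper_half_plane" for \<tau> n
    by (intro euler_prod_nonzero)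
       (use that in \<open>auto simp: upper_half_plane_def norm_power power_less_one_iff norm_qn_less_1_iff\<close>)
  show ?thesis
    unfolding g_eq_euler_prod[abs_def]
    using hol[of 1] hol[of 2] hol[of 5] hol[of 10] nz[of 1] nz[of 10]
    by (intro holomorphic_intros) auto
qed

theorem theorem3p8:
  shows "modular_function_Gamma0 10 (\<lambda>\<tau>. g1 \<tau> ^ 4 + g2 \<tau> ^ 4) \<and>
         (\<forall>\<tau>\<in>upper_half_plane. g1 \<tau> ^ 4 + g2 \<tau> ^ 4 = 1 / g \<tau> - 2 + 3 * g \<tau>)"
proof
  define f where "f = (\<lambda>\<tau>. g1 \<tau> ^ 4 + g2 \<tau> ^ 4)"
  have f: "f \<tau> = 1 / g \<tau> - 2 + 3 * g \<tau>" if "Im \<tau> > 0" for \<tau>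
    using g1_g2_relation[OF that] by (simp add: f_def)
  have op: "open upper_half_plane"
    unfolding upper_half_plane_def by (rule open_halfspace_Im_gt)
  have act: "Im (moebius_act a b c d \<tau>) > 0" if "a * d - b * c = 1" "Im \<tau> > 0" for a b c d \<tau>
    using Im_moebius_pos[of a d b c \<tau>] that by (simp add: moebius_act_def)
  have "(\<lambda>\<tau>. 1 / g \<tau> - 2 + 3 * g \<tau>) meromorphic_on upper_half_plane"
    by (intro meromorphic_intros analytic_on_imp_meromorphic_on)
       (use g_holomorphic op in \<open>simp_all add: analytic_on_open\<close>)
  \<comment> \<open>The identity is available on the upper half-plane only, so the functions are
    compared near its points, which suffices as it is open.\<close>
  moreover have "eventually (\<lambda>\<tau>. 1 / g \<tau> - 2 + 3 * g \<tau> = f \<tau>) (at z)" if "z \<in> upper_half_plane" for z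
    using eventually_at_in_open'[OF op that]
    by eventually_elim (simp add: f upper_half_plane_def)
  ultimately have mero: "f meromorphic_on upper_half_plane"
    using meromorphic_on_cong[OF _ refl, of upper_half_plane "\<lambda>\<tau>. 1 / g \<tau> - 2 + 3 * g \<tau>" f] by blast
  have inv: "f (moebius_act a b c d \<tau>) = f \<tau>" if "in_Gamma0 10 a b c d" "\<tau> \<in> upper_half_plane" for a b c d \<tau>
    using that g_Gamma0_invariant[OF that(1), of \<tau>] act[of a d b c \<tau>]
    by (simp add: f upper_half_plane_def in_Gamma0_def)
  have cusp: "meromorphic_at_cusp f a b c d" if det: "a * d - b * c = 1" for a b c d
  proof -
    obtain M where M: "M meromorphic_on {0}"
      "\<And>t. Im t > 0 \<Longrightarrow> g (moebius_act a b c d t) = M (qn (t / 40))"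
      using g_cusp_expansion[OF det] by blast
    define F where "F = (\<lambda>w. 1 / M w - 2 + 3 * M w)"
    have F: "f (moebius_act a b c d t) = F (qn (t / 40))" if "Im t > 0" for t
      using M(2)[OF that] f[OF act[OF det that]] by (simp add: F_def)
    have "F meromorphic_on {0}"
      unfolding F_def by (intro meromorphic_intros M)
    \<comment> \<open>For 0 < |w| < 1 the point \<open>t\<close> lies in the upper half-plane and
      \<open>qn (t / 40) = w\<close>, so the branch cut of \<open>Ln\<close> leaves no
      trace.\<close>
    moreover have "eventually (\<lambda>w. F w = f (moebius_act a b c d (of_nat 40 * Ln w / (2 * pi * \<i>)))) (at 0)"
    proof -
      have "eventually (\<lambda>w::complex. w \<in> ball 0 1 - {0}) (at 0)"
        by (intro eventually_at_in_open) auto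
      then show ?thesis
      proof eventually_elim
        case (elim w)
        then have w: "w \<noteq> 0" "norm w < 1" by auto
        define t where "t = of_nat 40 * Ln w / (2 * pi * \<i>)"
        have "Im t = - 20 * ln (norm w) / pi"
          using w by (simp add: t_def Im_divide power2_eq_square)
        also have "\<dots> > 0" using w by (simp add: divide_neg_pos)
        finally have "Im t > 0" .
        moreover have "qn (t / 40) = w" using w by (simp add: qn_def t_def)
        ultimately show ?case using F[of t] by (simp add: t_def)
      qed
    qed
    ultimately have "(\<lambda>w. f (moebius_act a b c d (of_nat 40 * Ln w / (2 * pi * \<i>)))) meromorphic_on {0}"
      by (subst meromorphic_on_cong[OF _ refl, of "{0}" _ F]) (auto simp: eq_commute)
    \<comment> \<open>The width 40 serves every cusp: adding it multiplies
      \<open>qn (\<tau> / 40)\<close> by \<open>qn 1\<close>, which is 1.\<close>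
    moreover have "f (moebius_act a b c d (\<tau> + of_nat 40)) = f (moebius_act a b c d \<tau>)"
      if "\<tau> \<in> upper_half_plane" for \<tau>
      using that F[of \<tau>] F[of "\<tau> + 40"] by (simp add: upper_half_plane_def add_divide_distrib qn_add)
    ultimately show ?thesis
      unfolding meromorphic_at_cusp_def by (intro exI[of _ 40]) auto
  qed
  show "modular_function_Gamma0 10 (\<lambda>\<tau>. g1 \<tau> ^ 4 + g2 \<tau> ^ 4)"
    using mero inv cusp unfolding modular_function_Gamma0_def f_def by blast
  show "\<forall>\<tau>\<in>upper_half_plane. g1 \<tau> ^ 4 + g2 \<tau> ^ 4 = 1 / g \<tau> - 2 + 3 * g \<tau>"
    using g1_g2_relation by (auto simp: upper_half_plane_def)
qed

end
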